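(* Let $W$ be a Coxeter group of rank at least $2$. (i) If $W$ is a finite Coxeter group, then $\mathrm{Diam}(\widehat{\mathcal{E}}_0(W))=1$ if $W=W(\mathrm{A}_2)$ or $W=W(\mathrm{A}_1\times\mathrm{A}_1)$, and $\mathrm{Diam}(\widehat{\mathcal{E}}_0(W))=3$ otherwise. (ii) If $W$ is an affine Coxeter group, then $\mathrm{Diam}(\widehat{\mathcal{E}}_0(W))=2$ if $W=W(\widetilde{\mathrm{A}}_1)$, and $\mathrm{Diam}(\widehat{\mathcal{E}}_0(W))=3$ otherwise. (iii) If $W$ is compact hyperbolic, then $\mathrm{Diam}(\widehat{\mathcal{E}}_0(W))=3$.
   Context: $W$ is a Coxeter group with set $R$ of fundamental reflections, rank $|R|$, and length function $\ell$ with respect to $R$. $\mathcal{I}(W)$ is the set of non-identity involutions of $W$. The excess zero graph $\mathcal{E}_0(W)$ has vertex set $\mathcal{I}(W)$, with $x,y\in\mathcal{I}(W)$ adjacent whenever $\ell(xy)=\ell(x)+\ell(y)$. $\widehat{\mathcal{E}}_0(W)$ is the connected component of $\mathcal{E}_0(W)$ not containing the longest element $w_0$ (which exists only when $W$ is finite): it is the induced subgraph on $\mathcal{I}(W)\setminus\{w_0\}$ if $W$ is finite, and all of $\mathcal{E}_0(W)$ if $W$ is infinite. $\mathrm{Diam}$ denotes graph diameter. $W(\Gamma)$ denotes the Coxeter group of type $\Gamma$; $W(\widetilde{\mathrm{A}}_1)$ is the infinite dihedral group, with $R=\{r,s\}$ and $m_{rs}=\infty$. An irreducible Coxeter group is compact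 hyperbolic if it is neither finite nor affine, but all its proper parabolic subgroups are finite. *)

theory Defs
  imports
    Complex_Main
    "HOL-Library.Extended_Real"
    "HOL-Algebra.Generated_Groups"
    "HOL-Algebra.Multiplicative_Group"
    "Graph_Theory.Graph_Theory"
begin

section \<open>Coxeter systems\<close>

definition word_prod :: "('a, 'b) monoid_scheme \<Rightarrow> 'a list \<Rightarrow> 'a" where
  "word_prod G ws = foldr (\<lambda>x y. x \<otimes>\<^bsub>G\<^esub> y) ws \<one>\<^bsub>G\<^esub>"

text \<open>The Coxeter matrix entry \<open>m\<^sub>r\<^sub>s\<close>, with \<open>0\<close> standing for \<open>\<infinity>\<close>: \<open>ord\<close> is \<open>0\<close> on elements of
  infinite order.\<close>
definition coxeter_m :: "('a, 'b) monoid_scheme \<Rightarrow> 'a \<Rightarrow> 'a \<Rightarrow> nat" where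
  "coxeter_m G r s = group.ord G (r \<otimes>\<^bsub>G\<^esub> s)"

text \<open>Insertion of a relator \<open>(r s)\<^sup>m\<close> with \<open>m = m\<^sub>r\<^sub>s\<close> into a word over \<open>R\<close>. For \<open>m\<^sub>r\<^sub>s = \<infinity>\<close> the inserted
  word is empty, so there is no relation; for \<open>r = s\<close> it is \<open>r r\<close>.\<close>
inductive relator_insert :: "('a, 'b) monoid_scheme \<Rightarrow> 'a set \<Rightarrow> 'a list \<Rightarrow> 'a list \<Rightarrow> bool"
  for G R where
  "\<lbrakk>u \<in> lists R; v \<in> lists R; r \<in> R; s \<in> R\<rbrakk> \<Longrightarrow>
     relator_insert G R (u @ v) (u @ concat (replicate (coxeter_m G r s) [r, s]) @ v)"

text \<open>\<open>(G, R)\<close> is a Coxeter system if \<open>R\<close> consists of elements of order two, generates \<open>G\<close>, and the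
  relations \<open>(r s)\<^sup>m = 1\<close>, with \<open>m\<close> the order of \<open>r s\<close> whenever that is finite, present \<open>G\<close>.
  As every generator is an involution, the presented group is the monoid of words over
  \<open>R\<close> modulo insertion and deletion of relators, and no formal inverses are needed.\<close>
locale coxeter_system = group G for G (structure) +
  fixes R :: "'a set"
  assumes gens_subset: "R \<subseteq> carrier G"
    and gens_involution: "\<And>r. r \<in> R \<Longrightarrow> r \<noteq> \<one> \<and> r \<otimes> r = \<one>"
    and gens_generate: "generate G R = carrier G"
    and presentation:
      "\<And>w. \<lbrakk>w \<in> lists R; word_prod G w = \<one>\<rbrakk> \<Longrightarrow> equivclp (relator_insert G R) w []"

definition coxeter_rank :: "'a set \<Rightarrow> enat" where
  "coxeter_rank R = (if finite R then enat (card R) else \<infinity>)"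

definition coxeter_length :: "('a, 'b) monoid_scheme \<Rightarrow> 'a set \<Rightarrow> 'a \<Rightarrow> nat" where
  "coxeter_length G R x = (LEAST n. \<exists>ws\<in>lists R. length ws = n \<and> word_prod G ws = x)"

text \<open>The longest element exists, and is then unique, only in a finite Coxeter group.\<close>
definition longest_element :: "('a, 'b) monoid_scheme \<Rightarrow> 'a set \<Rightarrow> 'a" where
  "longest_element G R =
     (THE x. x \<in> carrier G \<and> (\<forall>y\<in>carrier G. coxeter_length G R y \<le> coxeter_length G R x))"

section \<open>Classes of Coxeter groups\<close>

text \<open>Connectedness of the Coxeter diagram, in which \<open>r \<noteq> s\<close> are joined iff \<open>m\<^sub>r\<^sub>s \<noteq> 2\<close>.\<close>
definition coxeter_irreducible :: "('a, 'b) monoid_scheme \<Rightarrow> 'a set \<Rightarrow> bool" where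
  "coxeter_irreducible G R \<longleftrightarrow> R \<noteq> {} \<and>
     (\<forall>J. J \<noteq> {} \<and> J \<subset> R \<longrightarrow> (\<exists>r\<in>J. \<exists>s\<in>R - J. coxeter_m G r s \<noteq> 2))"

definition coxeter_form_entry :: "('a, 'b) monoid_scheme \<Rightarrow> 'a \<Rightarrow> 'a \<Rightarrow> real" where
  "coxeter_form_entry G r s =
     (if coxeter_m G r s = 0 then -1 else - cos (pi / real (coxeter_m G r s)))"

text \<open>The value \<open>B(v, v)\<close> of the canonical symmetric bilinear form at
  \<open>v = \<Sum>\<^sub>r v\<^sub>r \<alpha>\<^sub>r\<close>, where \<open>B(\<alpha>\<^sub>r, \<alpha>\<^sub>s) = - cos (\<pi> / m\<^sub>r\<^sub>s)\<close>.\<close>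
definition coxeter_quadratic_form ::
  "('a, 'b) monoid_scheme \<Rightarrow> 'a set \<Rightarrow> ('a \<Rightarrow> real) \<Rightarrow> real" where
  "coxeter_quadratic_form G R v = (\<Sum>r\<in>R. \<Sum>s\<in>R. coxeter_form_entry G r s * v r * v s)"

text \<open>Affine Coxeter groups are irreducible here: the form is positive
  semidefinite but not positive definite (Humphreys, Reflection Groups and Coxeter Groups,
  Section 6.5).\<close>
definition affine_coxeter :: "('a, 'b) monoid_scheme \<Rightarrow> 'a set \<Rightarrow> bool" where
  "affine_coxeter G R \<longleftrightarrow> finite R \<and> coxeter_irreducible G R \<and>
     (\<forall>v. 0 \<le> coxeter_quadratic_form G R v) \<and>
     \<not> (\<forall>v. (\<exists>r\<in>R. v r \<noteq> 0) \<longrightarrow> 0 < coxeter_quadratic_form G R v)"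

definition compact_hyperbolic :: "('a, 'b) monoid_scheme \<Rightarrow> 'a set \<Rightarrow> bool" where
  "compact_hyperbolic G R \<longleftrightarrow> coxeter_irreducible G R \<and>
     infinite (carrier G) \<and> \<not> affine_coxeter G R \<and>
     (\<forall>J. J \<subset> R \<longrightarrow> finite (generate G J))"

definition type_A1_A1 :: "('a, 'b) monoid_scheme \<Rightarrow> 'a set \<Rightarrow> bool" where
  "type_A1_A1 G R \<longleftrightarrow> (\<exists>r s. r \<noteq> s \<and> R = {r, s} \<and> coxeter_m G r s = 2)"

definition type_A2 :: "('a, 'b) monoid_scheme \<Rightarrow> 'a set \<Rightarrow> bool" where
  "type_A2 G R \<longleftrightarrow> (\<exists>r s. r \<noteq> s \<and> R = {r, s} \<and> coxeter_m G r s = 3)"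

definition type_affine_A1 :: "('a, 'b) monoid_scheme \<Rightarrow> 'a set \<Rightarrow> bool" where
  "type_affine_A1 G R \<longleftrightarrow> (\<exists>r s. r \<noteq> s \<and> R = {r, s} \<and> coxeter_m G r s = 0)"

section \<open>The excess zero graph\<close>

definition involutions :: "('a, 'b) monoid_scheme \<Rightarrow> 'a set" where
  "involutions G = {x \<in> carrier G. x \<noteq> \<one>\<^bsub>G\<^esub> \<and> x \<otimes>\<^bsub>G\<^esub> x = \<one>\<^bsub>G\<^esub>}"

text \<open>An undirected graph is a digraph with symmetric arc set. In a Coxeter system the arc set below
  is symmetric, since \<open>y x = (x y)\<inverse>\<close> for involutions, and it has no loops.\<close>
definition excess_zero_graph ::
  "('a, 'b) monoid_scheme \<Rightarrow> 'a set \<Rightarrow> ('a, 'a \<times> 'a) pre_digraph" where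
  "excess_zero_graph G R = with_proj
     \<lparr> pverts = involutions G,
       parcs = {(x, y). x \<in> involutions G \<and> y \<in> involutions G \<and>
         coxeter_length G R (x \<otimes>\<^bsub>G\<^esub> y) = coxeter_length G R x + coxeter_length G R y} \<rparr>"

definition reduced_excess_zero_graph ::
  "('a, 'b) monoid_scheme \<Rightarrow> 'a set \<Rightarrow> ('a, 'a \<times> 'a) pre_digraph" where
  "reduced_excess_zero_graph G R =
     (if finite (carrier G)
      then induce_subgraph (excess_zero_graph G R) (involutions G - {longest_element G R})
      else excess_zero_graph G R)"

text \<open>\<open>\<mu>\<close> with unit weights is the path distance, which is \<open>\<infinity>\<close> for vertices that no walk joins.
  It lives in the locale \<open>wf_digraph\<close>, see \<open>wf_reduced_excess_zero_graph\<close>.\<close>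
definition graph_diam :: "('v, 'e) pre_digraph \<Rightarrow> ereal" where
  "graph_diam \<Gamma> = (SUP x\<in>verts \<Gamma>. SUP y\<in>verts \<Gamma>. wf_digraph.\<mu> \<Gamma> (\<lambda>_. 1) x y)"

lemma wf_excess_zero_graph: "wf_digraph (excess_zero_graph G R)"
  unfolding excess_zero_graph_def by unfold_locales auto

lemma wf_reduced_excess_zero_graph: "wf_digraph (reduced_excess_zero_graph G R)"
  using wf_excess_zero_graph[of G R]
  unfolding reduced_excess_zero_graph_def by (auto intro: wf_digraph.wellformed_induce_subgraph)

end

theory Submission
  imports Defs
begin

text \<open>If involutions \<open>x\<close> and \<open>y\<close> are adjacent, their descent sets \<open>D(x)\<close> and \<open>D(y)\<close> are disjoint,
  and \<open>x\<close> is adjacent to every generator outside \<open>D(x)\<close>. The only element with \<open>D(x) = R\<close> is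
  \<open>w\<^sub>0\<close>, so any two vertices are joined by a path \<open>x, r, s, y\<close>, whence the upper bound \<open>3\<close>.
  Conversely, non-adjacent \<open>x\<close> and \<open>y\<close> with \<open>D(x) \<union> D(y) = R\<close> have no common neighbour \<open>z\<close>, since
  \<open>D(z)\<close> would be empty. The longest elements of two finite proper parabolic subgroups \<open>W\<^sub>J\<close>
  and \<open>W\<^sub>K\<close> with \<open>J \<union> K = R\<close> and \<open>J \<inter> K \<noteq> {}\<close> are such a pair. In rank at least \<open>3\<close> one takes
  \<open>J\<close> and \<open>K\<close> to be complements of two generators if all proper parabolic subgroups are finite.
  In the affine case finiteness of all of them is not needed: evaluating the form at indicator vectors
  shows that proper subdiagrams are forests, hence \<open>R - {v}\<close> splits into two sets of pairwise
  commuting generators, and adding \<open>v\<close> to both gives \<open>W\<^sub>J\<close> and \<open>W\<^sub>K\<close> that are products of groups of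
  type \<open>A\<^sub>1\<close>, one dihedral group or one group of type \<open>A\<^sub>3\<close>, if \<open>v\<close> is a leaf or, when there is no
  leaf, any generator.\<close>

section \<open>Auxiliary facts about lists\<close>

lemma count_list_distinct: "distinct xs \<Longrightarrow> x \<in> set xs \<Longrightarrow> count_list xs x = 1"
  by (induction xs) (auto simp: count_notin)

lemma append_eq_append_Cons:
  "ws @ u = p @ a # q \<Longrightarrow>
    (\<exists>r. ws = p @ a # r \<and> q = r @ u) \<or> (\<exists>r. u = r @ a # q \<and> p = ws @ r)"
  by (auto simp: append_eq_append_conv2 append_eq_Cons_conv Cons_eq_append_conv)

text \<open>At length \<open>2 * m\<close> this is the relator \<open>(r s)^m\<close>; at length up
  to the order of \<open>r s\<close> it is a reduced word of the dihedral subgroup generated by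
  \<open>r\<close> and \<open>s\<close>.\<close>

fun alt :: "'a \<Rightarrow> 'a \<Rightarrow> nat \<Rightarrow> 'a list" where
  "alt r s 0 = []"
| "alt r s (Suc k) = r # alt s r k"

section \<open>Words in the generators and the length function\<close>

context coxeter_system
begin

abbreviation len :: "'a \<Rightarrow> nat" where
  "len x \<equiv> coxeter_length G R x"

abbreviation wp :: "'a list \<Rightarrow> 'a" where
  "wp ws \<equiv> word_prod G ws"

declare in_lists_conv_set [simp] ball_Un [simp]

lemma word_prod_Nil [simp]: "wp [] = \<one>"
  by (simp add: word_prod_def)

lemma word_prod_Cons [simp]: "wp (s # ws) = s \<otimes> wp ws"
  by (simp add: word_prod_def)

lemma gen_closed [simp]: "s \<in> R \<Longrightarrow> s \<in> carrier G"
  using gens_subset by blast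

lemma gen_sq [simp]: "s \<in> R \<Longrightarrow> s \<otimes> s = \<one>"
  using gens_involution by blast

lemma gen_neq_one: "s \<in> R \<Longrightarrow> s \<noteq> \<one>"
  using gens_involution by blast

lemma gen_cancel [simp]: "s \<in> R \<Longrightarrow> x \<in> carrier G \<Longrightarrow> s \<otimes> (s \<otimes> x) = x"
  by (simp flip: m_assoc)

lemma inv_gen [simp]: "s \<in> R \<Longrightarrow> inv s = s"
  by (simp add: inv_equality)

lemma word_prod_closed [simp]: "ws \<in> lists R \<Longrightarrow> wp ws \<in> carrier G"
  by (induction ws) auto

lemma word_prod_append: "u \<in> lists R \<Longrightarrow> v \<in> lists R \<Longrightarrow> wp (u @ v) = wp u \<otimes> wp v"
  by (induction u) (auto simp: m_assoc)

lemma word_prod_rev: "u \<in> lists R \<Longrightarrow> wp (rev u) = inv (wp u)"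
  by (induction u) (auto simp: word_prod_append inv_mult_group)

lemma word_prod_in_generate: "ws \<in> lists J \<Longrightarrow> wp ws \<in> generate G J"
  by (induction ws) (auto intro: generate.intros)

text \<open>Each generator is its own inverse, so the inverse clause of \<open>generate\<close>
  again yields a one-letter word.\<close>

lemma generate_words:
  assumes "J \<subseteq> R" "x \<in> generate G J"
  obtains ws where "ws \<in> lists J" "wp ws = x"
proof -
  from assms(2) have "\<exists>ws. ws \<in> lists J \<and> wp ws = x"
  proof induction
    case one
    have "[] \<in> lists J \<and> wp [] = \<one>" by simp
    then show ?case by blast
  next
    case (incl h)
    then have "[h] \<in> lists J \<and> wp [h] = h" using assms(1) by auto
    then show ?case by blast
  next
    case (inv h)
    then have "[h] \<in> lists J \<and> wp [h] = inv h" using assms(1) by auto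
    then show ?case by blast
  next
    case (eng h1 h2)
    then obtain u v where *: "u \<in> lists J" "wp u = h1" "v \<in> lists J" "wp v = h2" by blast
    moreover have "lists J \<subseteq> lists R" using assms(1) by (rule lists_mono)
    ultimately have "u @ v \<in> lists J \<and> wp (u @ v) = h1 \<otimes> h2"
      using word_prod_append[of u v] by auto
    then show ?case by blast
  qed
  then show thesis using that by blast
qed

lemma ex_word:
  assumes "x \<in> carrier G"
  obtains ws where "ws \<in> lists R" "wp ws = x"
  using generate_words[of R x] gens_generate assms by blast

lemma length_le_word: "ws \<in> lists R \<Longrightarrow> len (wp ws) \<le> length ws"
  unfolding coxeter_length_def by (rule Least_le) blast

lemma ex_reduced_word:
  assumes "x \<in> carrier G"
  obtains ws where "ws \<in> lists R" "wp ws = x" "length ws = len x"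
proof -
  obtain ws where ws: "ws \<in> lists R" "wp ws = x" by (rule ex_word[OF assms])
  then have "\<exists>ws'\<in>lists R. length ws' = length ws \<and> wp ws' = x" by blast
  then have "\<exists>ws'\<in>lists R. length ws' = len x \<and> wp ws' = x"
    unfolding coxeter_length_def by (rule LeastI)
  then show thesis using that by blast
qed

lemma length_one [simp]: "len \<one> = 0"
  using length_le_word[of "[]"] by simp

lemma length_eq_0: "x \<in> carrier G \<Longrightarrow> len x = 0 \<longleftrightarrow> x = \<one>"
  by (metis ex_reduced_word length_0_conv length_one word_prod_Nil)

lemma length_mult_le:
  assumes "x \<in> carrier G" "y \<in> carrier G"
  shows "len (x \<otimes> y) \<le> len x + len y"
proof -
  obtain u where u: "u \<in> lists R" "wp u = x" "length u = len x"
    by (rule ex_reduced_word[OF assms(1)])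
  obtain v where v: "v \<in> lists R" "wp v = y" "length v = len y"
    by (rule ex_reduced_word[OF assms(2)])
  show ?thesis using length_le_word[of "u @ v"] u v by (simp add: word_prod_append ball_Un)
qed

lemma length_inv [simp]:
  assumes "x \<in> carrier G"
  shows "len (inv x) = len x"
proof -
  have le: "len (inv y) \<le> len y" if "y \<in> carrier G" for y
  proof -
    obtain u where u: "u \<in> lists R" "wp u = y" "length u = len y"
      by (rule ex_reduced_word[OF \<open>y \<in> carrier G\<close>])
    have "rev u \<in> lists R" using u by auto
    then show ?thesis using length_le_word[of "rev u"] u by (simp add: word_prod_rev)
  qed
  show ?thesis using le[of x] le[of "inv x"] assms by simp
qed

lemma length_gen: "s \<in> R \<Longrightarrow> len s = 1"
  using length_le_word[of "[s]"] length_eq_0[of s] gen_neq_one[of s] by simp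

section \<open>The reflections of a word\<close>

definition conj_by :: "'a \<Rightarrow> 'a \<Rightarrow> 'a" where
  "conj_by x t = x \<otimes> t \<otimes> inv x"

text \<open>For a word \<open>s1 ... sk\<close> the i-th entry is \<open>p si p^-1\<close> with the
  prefix \<open>p = s1 ... s(i-1)\<close>. Counting these reflections takes the place of the
  inversion set of a root system.\<close>

primrec refls :: "'a list \<Rightarrow> 'a list" where
  "refls [] = []"
| "refls (s # ws) = s # map (conj_by s) (refls ws)"

lemma conj_by_closed [simp]: "x \<in> carrier G \<Longrightarrow> t \<in> carrier G \<Longrightarrow> conj_by x t \<in> carrier G"
  by (simp add: conj_by_def)

lemma conj_by_one [simp]: "t \<in> carrier G \<Longrightarrow> conj_by \<one> t = t"
  by (simp add: conj_by_def)

lemma conj_by_mult: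
  "x \<in> carrier G \<Longrightarrow> y \<in> carrier G \<Longrightarrow> t \<in> carrier G \<Longrightarrow>
    conj_by (x \<otimes> y) t = conj_by x (conj_by y t)"
  by (simp add: conj_by_def m_assoc inv_mult_group)

lemma inj_on_conj_by: "x \<in> carrier G \<Longrightarrow> inj_on (conj_by x) (carrier G)"
  unfolding conj_by_def inj_on_def by auto

lemma refls_closed: "ws \<in> lists R \<Longrightarrow> set (refls ws) \<subseteq> carrier G"
  by (induction ws) auto

lemma length_refls [simp]: "length (refls ws) = length ws"
  by (induction ws) auto

lemma refls_append:
  "u \<in> lists R \<Longrightarrow> v \<in> lists R \<Longrightarrow> refls (u @ v) = refls u @ map (conj_by (wp u)) (refls v)"
proof (induction u)
  case Nil
  then show ?case using refls_closed[of v] by (auto intro!: map_idI[symmetric])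
next
  case (Cons a u)
  then show ?case using refls_closed[of v] by (auto simp: conj_by_mult subset_iff)
qed

text \<open>If \<open>t = p a p^-1\<close> comes from the letter \<open>a\<close> after the prefix
  \<open>p\<close>, left multiplication by \<open>t\<close> cancels exactly this occurrence of
  \<open>a\<close>.\<close>

lemma refls_delete:
  "ws \<in> lists R \<Longrightarrow> t \<in> set (refls ws) \<Longrightarrow> \<exists>u a v. ws = u @ a # v \<and> t \<otimes> wp ws = wp (u @ v)"
proof (induction ws arbitrary: t)
  case (Cons s ws)
  show ?case
  proof (cases "t = s")
    case True
    have "s \<in> R" "ws \<in> lists R" using Cons.prems(1) by auto
    with True show ?thesis by (intro exI[of _ "[]"] exI[of _ s] exI[of _ ws]) simp
  next
    case False
    then obtain t' where t': "t' \<in> set (refls ws)" "t = conj_by s t'" using Cons.prems by auto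
    have ws: "s \<in> R" "ws \<in> lists R" using Cons.prems by auto
    obtain u a v where uav: "ws = u @ a # v" "t' \<otimes> wp ws = wp (u @ v)"
      using Cons.IH[OF ws(2) t'(1)] by blast
    have "t' \<in> carrier G" using t' refls_closed ws by blast
    then have "t \<otimes> wp (s # ws) = s \<otimes> (t' \<otimes> wp ws)"
      using t'(2) ws word_prod_closed[OF ws(2)] by (simp add: conj_by_def m_assoc)
    with uav(2) have "t \<otimes> wp (s # ws) = wp ((s # u) @ v)" by simp
    moreover have "s # ws = (s # u) @ a # v" using uav(1) by simp
    ultimately show ?thesis by blast
  qed
qed simp

section \<open>Alternating words and the parity of reflection multiplicities\<close>

lemma length_alt [simp]: "length (alt r s k) = k"
  by (induction r s k rule: alt.induct) auto

lemma alt_in_lists: "r \<in> J \<Longrightarrow> s \<in> J \<Longrightarrow> alt r s k \<in> lists J"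
  by (induction r s k rule: alt.induct) auto

lemma concat_replicate_alt: "concat (replicate m [r, s]) = alt r s (2 * m)"
  by (induction m) auto

lemma word_prod_alt_even:
  assumes "r \<in> R" "s \<in> R"
  shows "wp (alt r s (2 * k)) = (r \<otimes> s) [^] k"
proof (induction k)
  case (Suc k)
  have "(r \<otimes> s) [^] Suc k = (r \<otimes> s) \<otimes> (r \<otimes> s) [^] k"
    using assms by (intro nat_pow_Suc2) simp
  then show ?case using Suc assms by (simp add: m_assoc)
qed simp

lemma word_prod_alt_odd:
  assumes "r \<in> R" "s \<in> R"
  shows "wp (alt r s (Suc (2 * k))) = (r \<otimes> s) [^] k \<otimes> r"
proof (induction k)
  case (Suc k)
  have "(r \<otimes> s) [^] Suc k = (r \<otimes> s) \<otimes> (r \<otimes> s) [^] k"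
    using assms by (intro nat_pow_Suc2) simp
  then show ?case using Suc assms by (simp add: m_assoc)
qed (use assms in simp)

text \<open>Both sides are the alternating word of length \<open>2 * i + 1\<close> beginning with
  \<open>r\<close>, bracketed differently.\<close>

lemma pow_shift:
  assumes "r \<in> R" "s \<in> R"
  shows "r \<otimes> (s \<otimes> r) [^] (i::nat) = (r \<otimes> s) [^] i \<otimes> r"
proof (induction i)
  case (Suc i)
  have "r \<otimes> (s \<otimes> r) [^] Suc i = (r \<otimes> (s \<otimes> r) [^] i) \<otimes> (s \<otimes> r)"
    using assms by (simp add: m_assoc)
  also have "\<dots> = (r \<otimes> s) [^] Suc i \<otimes> r"
    using Suc assms by (simp add: m_assoc)
  finally show ?case .
qed (use assms in simp)

text \<open>Conjugation by \<open>r\<close> turns \<open>(s r)^i s\<close> into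
  \<open>(r s)^(i+1) r\<close>. The explicit list shows both that the reflections of a relator pair
  up and that short alternating words are reduced.\<close>

lemma refls_alt:
  "r \<in> R \<Longrightarrow> s \<in> R \<Longrightarrow> refls (alt r s k) = map (\<lambda>i. (r \<otimes> s) [^] i \<otimes> r) [0..<k]"
proof (induction k arbitrary: r s)
  case (Suc k)
  have "conj_by r ((s \<otimes> r) [^] i \<otimes> s) = (r \<otimes> s) [^] Suc i \<otimes> r" for i :: nat
  proof -
    have "conj_by r ((s \<otimes> r) [^] i \<otimes> s) = (r \<otimes> (s \<otimes> r) [^] i) \<otimes> s \<otimes> r"
      using Suc.prems by (simp add: conj_by_def m_assoc)
    then show ?thesis using Suc.prems by (simp add: pow_shift m_assoc)
  qed
  then have "refls (alt r s (Suc k)) = r # map (\<lambda>i. (r \<otimes> s) [^] Suc i \<otimes> r) [0..<k]"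
    using Suc by (simp add: o_def)
  also have "\<dots> = map (\<lambda>i. (r \<otimes> s) [^] i \<otimes> r) [0..<Suc k]"
    unfolding upt_conv_Cons[OF zero_less_Suc] list.map map_Suc_upt[symmetric] map_map o_def
    using Suc.prems by simp
  finally show ?case .
qed simp

text \<open>The reflection \<open>(r s)^i r\<close> depends only on \<open>i\<close> modulo
  \<open>m\<close>, so the \<open>2 m\<close> reflections of the relator run through the same list
  twice. For an infinite label the relator is empty and so is \<open>L\<close>.\<close>

lemma refls_relator:
  assumes "r \<in> R" "s \<in> R"
  shows "\<exists>L. set L \<subseteq> carrier G \<and> refls (concat (replicate (coxeter_m G r s) [r, s])) = L @ L"
proof -
  let ?m = "coxeter_m G r s"
  let ?f = "\<lambda>i::nat. (r \<otimes> s) [^] i \<otimes> r"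
  have m1: "(r \<otimes> s) [^] ?m = \<one>" using assms unfolding coxeter_m_def by simp
  have "map ?f [?m..<2 * ?m] = map ?f [0..<?m]"
    using assms by (intro nth_equalityI) (auto simp: m1 nat_pow_mult[symmetric])
  moreover have "[0..<2 * ?m] = [0..<?m] @ [?m..<2 * ?m]"
    using upt_add_eq_append[of 0 ?m ?m] by (simp add: mult_2)
  ultimately have "refls (concat (replicate ?m [r, s])) = map ?f [0..<?m] @ map ?f [0..<?m]"
    using assms by (simp add: concat_replicate_alt refls_alt)
  then show ?thesis using assms by (intro exI[of _ "map ?f [0..<?m]"]) auto
qed

lemma word_prod_relator:
  assumes "r \<in> R" "s \<in> R"
  shows "wp (concat (replicate (coxeter_m G r s) [r, s])) = \<one>"
  using assms by (simp add: concat_replicate_alt word_prod_alt_even coxeter_m_def)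

text \<open>The relator has value 1, so the reflections of the tail \<open>v\<close> stay the same;
  the relator itself adds a conjugate of \<open>L @ L\<close>, hence an even multiplicity of every
  \<open>t\<close>.\<close>

lemma relator_insert_refls:
  assumes "relator_insert G R w w'"
  shows "w \<in> lists R \<and> w' \<in> lists R \<and> (even (length w) \<longleftrightarrow> even (length w')) \<and>
    (even (count_list (refls w) t) \<longleftrightarrow> even (count_list (refls w') t))"
  using assms
proof cases
  case (1 u v r s)
  let ?rel = "concat (replicate (coxeter_m G r s) [r, s])"
  have rel: "?rel \<in> lists R"
    using 1 alt_in_lists[of r R s] by (simp add: concat_replicate_alt)
  obtain L where L: "refls ?rel = L @ L" using refls_relator 1 by blast
  have "refls (u @ ?rel @ v) =
      refls u @ map (conj_by (wp u)) (L @ L @ map (conj_by (wp ?rel)) (refls v))"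
    using 1 rel L by (simp add: refls_append)
  also have "map (conj_by (wp ?rel)) (refls v) = refls v"
    using 1 refls_closed[of v] by (intro map_idI) (auto simp: word_prod_relator)
  finally have "count_list (refls w') t =
      count_list (refls w) t + 2 * count_list (map (conj_by (wp u)) L) t"
    using 1 by (simp add: refls_append)
  moreover have "length w' = length w + 2 * coxeter_m G r s"
    using 1 by (simp add: concat_replicate_alt)
  moreover have "w \<in> lists R" "w' \<in> lists R" using 1 rel by auto
  ultimately show ?thesis by simp
qed

text \<open>Both parities are carried along the chain of insertions and deletions that joins
  \<open>w\<close> to the empty word. This is where \<open>presentation\<close> enters.\<close>

lemma word_prod_one_parity:
  assumes "w \<in> lists R" "wp w = \<one>"
  shows "even (length w) \<and> even (count_list (refls w) t)"
proof -
  have "(even (length w) \<longleftrightarrow> even (length v)) \<and>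
      (even (count_list (refls w) t) \<longleftrightarrow> even (count_list (refls v) t))"
    if "equivclp (relator_insert G R) w v" for v
    using that
  proof (induction rule: equivclp_induct)
    case (step y z)
    then show ?case using relator_insert_refls[of y z t] relator_insert_refls[of z y t] by blast
  qed simp
  from this[OF presentation[OF assms]] show ?thesis by simp
qed

text \<open>Appending \<open>rev v\<close> to both words gives two words of value 1, and the
  appended part contributes the same reflections to both because \<open>u\<close> and
  \<open>v\<close> have the same value.\<close>

lemma word_prod_eq_parity:
  assumes "u \<in> lists R" "v \<in> lists R" "wp u = wp v"
  shows "even (length u) \<longleftrightarrow> even (length v)"
    and "even (count_list (refls u) t) \<longleftrightarrow> even (count_list (refls v) t)"
proof -
  have rv: "rev v \<in> lists R" using assms by auto
  then have "wp (u @ rev v) = \<one>" "wp (v @ rev v) = \<one>" "u @ rev v \<in> lists R" "v @ rev v \<in> lists R"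
    using assms by (auto simp: word_prod_append word_prod_rev)
  then have "even (length (u @ rev v)) \<and> even (count_list (refls (u @ rev v)) t)"
    "even (length (v @ rev v)) \<and> even (count_list (refls (v @ rev v)) t)"
    using word_prod_one_parity by blast+
  then show "even (length u) \<longleftrightarrow> even (length v)"
    "even (count_list (refls u) t) \<longleftrightarrow> even (count_list (refls v) t)"
    using assms rv by (auto simp: refls_append)
qed

section \<open>Exchange and deletion\<close>

lemma length_gen_mult_parity:
  assumes "s \<in> R" "x \<in> carrier G"
  shows "even (len (s \<otimes> x)) \<longleftrightarrow> odd (len x)"
proof -
  obtain u where u: "u \<in> lists R" "wp u = x" "length u = len x"
    by (rule ex_reduced_word[OF assms(2)])
  obtain v where v: "v \<in> lists R" "wp v = s \<otimes> x" "length v = len (s \<otimes> x)"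
    by (rule ex_reduced_word[of "s \<otimes> x"]) (use assms in auto)
  have "s # u \<in> lists R" using assms u by simp
  then have "even (length v) \<longleftrightarrow> even (length (s # u))"
    using v u by (intro word_prod_eq_parity) auto
  then show ?thesis using u v by simp
qed

text \<open>The triangle inequality bounds the difference by one, and parity excludes zero.\<close>

lemma length_gen_mult:
  assumes "s \<in> R" "x \<in> carrier G"
  shows "len (s \<otimes> x) = Suc (len x) \<or> Suc (len (s \<otimes> x)) = len x"
proof -
  have "len (s \<otimes> x) \<le> Suc (len x)" using length_mult_le[of s x] assms by (simp add: length_gen)
  moreover have "len x \<le> Suc (len (s \<otimes> x))"
    using length_mult_le[of s "s \<otimes> x"] assms by (simp add: length_gen)
  moreover have "len (s \<otimes> x) \<noteq> len x" using length_gen_mult_parity[OF assms] by auto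
  ultimately show ?thesis by linarith
qed

text \<open>If the first reflection \<open>s\<close> recurred later, as a conjugate of
  \<open>t\<close> by \<open>s\<close>, then \<open>t = s\<close>, and deleting the letter of
  \<open>ws\<close> that belongs to \<open>t\<close> would express the element by a shorter
  word.\<close>

lemma reduced_distinct_refls:
  "ws \<in> lists R \<Longrightarrow> length ws = len (wp ws) \<Longrightarrow> distinct (refls ws)"
proof (induction ws)
  case (Cons s ws)
  have ws: "s \<in> R" "ws \<in> lists R" using Cons.prems by auto
  have "Suc (length ws) \<le> Suc (len (wp ws))"
    using Cons.prems length_gen_mult[of s "wp ws"] ws by auto
  then have red: "length ws = len (wp ws)" using length_le_word[OF ws(2)] by simp
  then have d: "distinct (refls ws)" using Cons ws by simp
  have "s \<notin> set (map (conj_by s) (refls ws))"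
  proof
    assume "s \<in> set (map (conj_by s) (refls ws))"
    then obtain t where t: "t \<in> set (refls ws)" "s = conj_by s t" by auto
    have tc: "t \<in> carrier G" using t refls_closed ws by blast
    have "conj_by s s = conj_by s t" using t ws by (simp add: conj_by_def)
    then have "t = s" using inj_on_conj_by[of s] tc ws by (auto dest!: inj_onD)
    then obtain u a v where "ws = u @ a # v" "s \<otimes> wp ws = wp (u @ v)"
      using refls_delete t ws by blast
    moreover from this have "u @ v \<in> lists R" using ws by auto
    ultimately show False using length_le_word[of "u @ v"] Cons.prems by simp
  qed
  moreover have "inj_on (conj_by s) (set (refls ws))"
    using inj_on_conj_by[of s] ws refls_closed[of ws] by (auto intro: inj_on_subset)
  ultimately show ?case using d by (simp add: distinct_map)
qed simp

text \<open>Compared with a reduced word \<open>v\<close> of the same element, a reflection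
  occurring once in \<open>refls ws\<close> has odd multiplicity in \<open>refls v\<close>. So
  \<open>v\<close> has at least as many letters as \<open>ws\<close>.\<close>

lemma distinct_refls_reduced:
  assumes "ws \<in> lists R" "distinct (refls ws)"
  shows "length ws = len (wp ws)"
proof -
  obtain v where v: "v \<in> lists R" "wp v = wp ws" "length v = len (wp ws)"
    by (rule ex_reduced_word[of "wp ws"]) (use assms in auto)
  have "set (refls ws) \<subseteq> set (refls v)"
  proof
    fix t assume "t \<in> set (refls ws)"
    then have "count_list (refls ws) t = 1" using assms(2) by (simp add: count_list_distinct)
    then have "odd (count_list (refls v) t)"
      using word_prod_eq_parity(2)[of v ws t] v assms(1) by simp
    then show "t \<in> set (refls v)" by (metis count_notin even_zero)
  qed
  then have "card (set (refls ws)) \<le> card (set (refls v))" by (intro card_mono) auto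
  also have "\<dots> \<le> length v" using card_length[of "refls v"] by simp
  finally have "length ws \<le> len (wp ws)" using distinct_card[OF assms(2)] v by simp
  then show ?thesis using length_le_word[OF assms(1)] by simp
qed

text \<open>For a reduced word \<open>v\<close> of \<open>s \<otimes> wp ws\<close> the word
  \<open>s # v\<close> is reduced and has \<open>s\<close> among its reflections exactly once. By
  parity \<open>s\<close> is also a reflection of \<open>ws\<close>, and the corresponding letter
  can be deleted.\<close>

lemma exchange:
  assumes "ws \<in> lists R" "s \<in> R" "len (s \<otimes> wp ws) < len (wp ws)"
  shows "\<exists>u a v. ws = u @ a # v \<and> s \<otimes> wp ws = wp (u @ v)"
proof -
  obtain v where v: "v \<in> lists R" "wp v = s \<otimes> wp ws" "length v = len (s \<otimes> wp ws)"
    by (rule ex_reduced_word[of "s \<otimes> wp ws"]) (use assms in auto)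
  have sv: "wp (s # v) = wp ws" "s # v \<in> lists R" using v assms by auto
  have "length (s # v) = len (wp (s # v))"
    using v assms length_gen_mult[of s "wp ws"] sv by auto
  then have "distinct (refls (s # v))" using reduced_distinct_refls sv by blast
  then have "count_list (refls (s # v)) s = 1" by (simp add: count_list_distinct)
  then have "odd (count_list (refls ws) s)"
    using word_prod_eq_parity(2)[of ws "s # v" s] sv assms(1) by simp
  then have "s \<in> set (refls ws)" by (metis count_notin even_zero)
  then show ?thesis using refls_delete assms(1) by blast
qed

text \<open>A reduced word is built from the right: a letter that lengthens is kept, one that
  shortens is absorbed by the exchange condition. As no new letters arise, elements of a parabolic
  subgroup have reduced words in its own generators.\<close>

lemma reduced_subword:
  assumes "ws \<in> lists R"
  shows "\<exists>v. v \<in> lists R \<and> set v \<subseteq> set ws \<and> wp v = wp ws \<and> length v = len (wp ws)"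
  using assms
proof (induction ws)
  case Nil
  then show ?case by (intro exI[of _ "[]"]) simp
next
  case (Cons s ws)
  then have s: "s \<in> R" by simp
  from Cons obtain v where v: "v \<in> lists R" "set v \<subseteq> set ws" "wp v = wp ws" "length v = len (wp ws)"
    by auto
  show ?case
  proof (cases "len (s \<otimes> wp v) < len (wp v)")
    case True
    then obtain a b c where abc: "v = a @ b # c" "s \<otimes> wp v = wp (a @ c)"
      using exchange[OF v(1) s] by blast
    have "len (wp (a @ c)) = length (a @ c)"
      using length_gen_mult[of s "wp v"] True abc v s word_prod_closed[of v] by auto
    then show ?thesis using abc v by (intro exI[of _ "a @ c"]) auto
  next
    case False
    then have "len (s \<otimes> wp v) = Suc (len (wp v))"
      using length_gen_mult[of s "wp v"] v s word_prod_closed[of v] by auto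
    then show ?thesis using v s by (intro exI[of _ "s # v"]) auto
  qed
qed

section \<open>Descent sets\<close>

text \<open>These are left descents. For an involution \<open>x\<close> they are also the right
  descents, since \<open>x s\<close> is the inverse of \<open>s x\<close>.\<close>

definition descents :: "'a \<Rightarrow> 'a set" where
  "descents x = {s \<in> R. len (s \<otimes> x) < len x}"

lemma descents_subset: "descents x \<subseteq> R"
  by (auto simp: descents_def)

lemma not_descent_length:
  "x \<in> carrier G \<Longrightarrow> s \<in> R \<Longrightarrow> s \<notin> descents x \<Longrightarrow> len (s \<otimes> x) = Suc (len x)"
  using length_gen_mult[of s x] by (auto simp: descents_def)

lemma descent_length:
  "x \<in> carrier G \<Longrightarrow> s \<in> descents x \<Longrightarrow> Suc (len (s \<otimes> x)) = len x"
  using length_gen_mult[of s x] by (auto simp: descents_def)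

lemma descents_one [simp]: "descents \<one> = {}"
  by (auto simp: descents_def)

lemma descents_nonempty:
  assumes "x \<in> carrier G" "x \<noteq> \<one>"
  shows "descents x \<noteq> {}"
proof -
  obtain ws where ws: "ws \<in> lists R" "wp ws = x" "length ws = len x"
    by (rule ex_reduced_word[OF assms(1)])
  then obtain s v where sv: "ws = s # v" using assms(2) by (cases ws) auto
  then have s: "s \<in> R" "v \<in> lists R" "x = s \<otimes> wp v" using ws by auto
  then have "s \<otimes> x = wp v" by simp
  then have "len (s \<otimes> x) < len x" using length_le_word[OF s(2)] ws(3) sv by simp
  then show ?thesis using s by (auto simp: descents_def)
qed

text \<open>A reduced word for \<open>r\<close> with letters in \<open>J\<close> has a single
  letter, which must be \<open>r\<close>.\<close>

lemma gen_in_generate: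
  assumes "J \<subseteq> R" "r \<in> R" "r \<in> generate G J"
  shows "r \<in> J"
proof -
  obtain ws where ws: "ws \<in> lists J" "wp ws = r" by (rule generate_words[OF assms(1,3)])
  then have "ws \<in> lists R" using assms(1) by auto
  then obtain v where v: "v \<in> lists R" "set v \<subseteq> set ws" "wp v = r" "length v = 1"
    using reduced_subword[of ws] ws length_gen[OF assms(2)] by auto
  then obtain a where "v = [a]" by (auto simp: length_Suc_conv)
  then show ?thesis using v ws by auto
qed

lemma generate_closed: "J \<subseteq> R \<Longrightarrow> x \<in> generate G J \<Longrightarrow> x \<in> carrier G"
  using gens_subset generate_in_carrier[of J x] by blast

text \<open>An element having all of \<open>J\<close> as descents begins with every element of \<open>\<langle>J\<rangle>\<close>: in the
  inductive step the letter removed by the exchange condition cannot lie in the part already split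
  off, since that part would become non-reduced.\<close>

lemma length_prefix_word:
  assumes "x \<in> carrier G" "J \<subseteq> descents x"
  shows "ws \<in> lists J \<Longrightarrow> length ws = len (wp ws) \<Longrightarrow> len x = length ws + len (inv (wp ws) \<otimes> x)"
proof (induction ws)
  case (Cons s ws)
  have J: "J \<subseteq> R" using assms(2) descents_subset by blast
  have s: "s \<in> J" "s \<in> R" "ws \<in> lists J" "ws \<in> lists R" using Cons.prems J by auto
  let ?w = "wp ws"
  have w: "?w \<in> carrier G" using s by simp
  have "Suc (length ws) \<le> Suc (len ?w)"
    using Cons.prems length_gen_mult[of s ?w] s w by auto
  then have red: "length ws = len ?w" using length_le_word[OF s(4)] by simp
  have IH: "len x = length ws + len (inv ?w \<otimes> x)" using Cons.IH red s by blast
  obtain u where u: "u \<in> lists R" "wp u = inv ?w \<otimes> x" "length u = len (inv ?w \<otimes> x)"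
    by (rule ex_reduced_word[of "inv ?w \<otimes> x"]) (use assms w in auto)
  have wu: "wp (ws @ u) = x" using u s w assms(1) by (simp only: word_prod_append) (simp flip: m_assoc)
  have "len (s \<otimes> x) < len x" using s assms(2) by (auto simp: descents_def)
  then obtain p a q where paq: "ws @ u = p @ a # q" "s \<otimes> x = wp (p @ q)"
    using exchange[of "ws @ u" s] unfolding wu using u s by auto
  from append_eq_append_Cons[OF paq(1)] show ?case
  proof (elim disjE exE conjE)
    fix r assume r: "ws = p @ a # r" "q = r @ u"
    have pr: "p @ r \<in> lists R" using r s by auto
    have "s \<otimes> x = wp (p @ r) \<otimes> wp u"
      using paq r pr u word_prod_append[of "p @ r" u] by auto
    moreover have "s \<otimes> x = (s \<otimes> ?w) \<otimes> wp u"
      using u(2) s w assms(1) by (simp add: m_assoc) (simp flip: m_assoc)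
    ultimately have "s \<otimes> ?w = wp (p @ r)"
      using s w u(1) pr by (metis gen_closed m_closed right_cancel word_prod_closed)
    then have "len (wp (s # ws)) \<le> length (p @ r)" using length_le_word[OF pr] by simp
    then show ?thesis using Cons.prems r by simp
  next
    fix r assume r: "u = r @ a # q" "p = ws @ r"
    have rq: "r @ q \<in> lists R" using r u by auto
    have "s \<otimes> x = ?w \<otimes> wp (r @ q)"
      using paq r rq s word_prod_append[of ws "r @ q"] by auto
    then have "inv (wp (s # ws)) \<otimes> x = wp (r @ q)"
      using s w assms(1) word_prod_closed[OF rq]
      by (simp add: inv_mult_group m_assoc) (simp flip: m_assoc)
    then have "len (inv (wp (s # ws)) \<otimes> x) \<le> length (r @ q)"
      using length_le_word[OF rq] by simp
    moreover have "len x \<le> len (wp (s # ws)) + len (inv (wp (s # ws)) \<otimes> x)"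
      using length_mult_le[of "wp (s # ws)" "inv (wp (s # ws)) \<otimes> x"] s w assms(1)
      by (simp flip: m_assoc)
    ultimately show ?thesis using Cons.prems IH u(3) r by simp
  qed
qed (use assms in simp)

lemma length_prefix:
  assumes "x \<in> carrier G" "J \<subseteq> descents x" "w \<in> generate G J"
  shows "len x = len w + len (inv w \<otimes> x)"
proof -
  have J: "J \<subseteq> R" using assms(2) descents_subset by blast
  obtain ws where ws: "ws \<in> lists J" "wp ws = w" by (rule generate_words[OF J assms(3)])
  then have "ws \<in> lists R" using J by auto
  then obtain v where v: "set v \<subseteq> set ws" "wp v = w" "length v = len w"
    using reduced_subword[of ws] ws by auto
  then have "v \<in> lists J" using ws by auto
  then show ?thesis using length_prefix_word[OF assms(1,2), of v] v by simp
qed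

text \<open>With \<open>J = R\<close> every \<open>w\<close> is a prefix of \<open>x\<close> without
  loss of length; if the lengths agree, the remaining factor has length 0.\<close>

lemma full_descents_length:
  assumes "x \<in> carrier G" "descents x = R" "w \<in> carrier G"
  shows "len w \<le> len x" "len w = len x \<Longrightarrow> w = x"
proof -
  have "w \<in> generate G R" using assms(3) gens_generate by simp
  then have eq: "len x = len w + len (inv w \<otimes> x)"
    using length_prefix[of x R w] assms by simp
  then show "len w \<le> len x" by simp
  assume "len w = len x"
  then have "len (inv w \<otimes> x) = 0" using eq by simp
  then have "inv w \<otimes> x = \<one>" using length_eq_0 assms by simp
  then show "w = x" using assms by (metis inv_equality inv_inv inv_closed)
qed

text \<open>All lengths are at most \<open>len x\<close>, and there are finitely many words of
  bounded length. So in an infinite group with finite \<open>R\<close> no element has full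
  descents.\<close>

lemma full_descents_finite:
  assumes "x \<in> carrier G" "descents x = R" "finite R"
  shows "finite (carrier G)"
proof -
  have "carrier G \<subseteq> wp ` {ws. set ws \<subseteq> R \<and> length ws \<le> len x}"
  proof
    fix w assume w: "w \<in> carrier G"
    obtain ws where "ws \<in> lists R" "wp ws = w" "length ws = len w"
      by (rule ex_reduced_word[OF w])
    then show "w \<in> wp ` {ws. set ws \<subseteq> R \<and> length ws \<le> len x}"
      using full_descents_length(1)[OF assms(1,2) w] by auto
  qed
  then show ?thesis using finite_lists_length_le[OF assms(3)] by (auto intro: finite_subset)
qed

text \<open>An element of maximal length in the finite subgroup cannot be lengthened by any
  \<open>s\<close> in \<open>J\<close>, because \<open>s \<otimes> x\<close> stays in the
  subgroup.\<close>

lemma ex_full_descents: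
  assumes "J \<subseteq> R" "finite (generate G J)"
  obtains x where "x \<in> generate G J" "J \<subseteq> descents x"
    "\<And>y. y \<in> generate G J \<Longrightarrow> len y \<le> len x"
proof -
  let ?W = "generate G J"
  have "?W \<noteq> {}" using generate.one by blast
  then obtain x where "x \<in> ?W" "Max (len ` ?W) = len x"
    using obtains_MAX[OF assms(2)] by blast
  then have x: "x \<in> ?W" "\<And>y. y \<in> ?W \<Longrightarrow> len y \<le> len x"
    using Max_ge[of "len ` ?W"] assms(2) by auto
  have xc: "x \<in> carrier G" using generate_closed assms(1) x(1) by blast
  have "J \<subseteq> descents x"
  proof
    fix s assume s: "s \<in> J"
    then have "s \<otimes> x \<in> ?W" using generate.eng[OF generate.incl[OF s] x(1)] by simp
    then have "len (s \<otimes> x) \<le> len x" using x by blast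
    then show "s \<in> descents x"
      using not_descent_length[OF xc, of s] s assms(1) by (cases "s \<in> descents x") auto
  qed
  then show thesis using that x by blast
qed

text \<open>Replaces the description of the longest element by a condition on descents, in which the
  excluded vertex can be handled.\<close>

lemma longest_element_iff:
  assumes "finite (carrier G)" "x \<in> carrier G"
  shows "x = longest_element G R \<longleftrightarrow> descents x = R"
proof -
  obtain z where "z \<in> generate G R" "R \<subseteq> descents z"
    by (rule ex_full_descents[of R]) (use assms gens_generate in auto)
  then have z: "z \<in> carrier G" "descents z = R"
    using gens_generate descents_subset by auto
  have "longest_element G R = z"
    unfolding longest_element_def
  proof (rule the_equality)
    show "z \<in> carrier G \<and> (\<forall>y\<in>carrier G. len y \<le> len z)"
      using z full_descents_length by blast
    fix y assume "y \<in> carrier G \<and> (\<forall>w\<in>carrier G. len w \<le> len y)"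
    then show "y = z" using full_descents_length[OF z, of y] z by (meson le_antisym)
  qed
  then show ?thesis using z full_descents_length[OF assms(2) _ z(1)] full_descents_length[OF z assms(2)]
    by (metis le_antisym)
qed

text \<open>The witness is the longest element \<open>x\<close> of the parabolic subgroup. Its
  inverse is a prefix of \<open>x\<close> of the same length, so \<open>x \<otimes> x\<close> has
  length 0. A descent \<open>r\<close> outside \<open>J\<close> would, by the exchange condition,
  place \<open>r \<otimes> x\<close> and hence \<open>r\<close> in the subgroup.\<close>

lemma parabolic_involution:
  assumes "J \<subseteq> R" "J \<noteq> {}" "finite (generate G J)"
  obtains x where "x \<in> involutions G" "descents x = J"
proof -
  obtain x where x: "x \<in> generate G J" "J \<subseteq> descents x"
    by (rule ex_full_descents[OF assms(1,3)])
  have xc: "x \<in> carrier G" using generate_closed assms(1) x(1) by blast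
  have "J \<subseteq> carrier G" using assms(1) gens_subset by blast
  then have ix: "inv x \<in> generate G J" using generate_m_inv_closed x(1) by blast
  have "len (x \<otimes> x) = 0" using length_prefix[OF xc x(2) ix] xc by simp
  then have "x \<otimes> x = \<one>" using length_eq_0 xc by simp
  moreover have "x \<noteq> \<one>" using x(2) assms(2) by auto
  ultimately have "x \<in> involutions G" using xc by (simp add: involutions_def)
  moreover have "descents x \<subseteq> J"
  proof
    fix r assume r: "r \<in> descents x"
    then have rR: "r \<in> R" using descents_subset by blast
    obtain ws where ws: "ws \<in> lists J" "wp ws = x" by (rule generate_words[OF assms(1) x(1)])
    then have "ws \<in> lists R" using assms(1) by auto
    then obtain u a v where uav: "ws = u @ a # v" "r \<otimes> x = wp (u @ v)"
      using exchange[of ws r] rR r unfolding ws(2) descents_def by blast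
    then have "u @ v \<in> lists J" using ws(1) by simp
    with uav(2) have rx: "r \<otimes> x \<in> generate G J" using word_prod_in_generate by metis
    have "r \<otimes> x \<otimes> inv x \<in> generate G J" by (rule generate.eng[OF rx ix])
    then have "r \<in> generate G J" using xc rR by (simp add: m_assoc)
    then show "r \<in> J" using gen_in_generate assms(1) rR by blast
  qed
  ultimately show thesis using that x(2) by blast
qed

section \<open>Distances in the excess zero graph\<close>

text \<open>For finite \<open>R\<close> this is the vertex set of the reduced graph in both cases:
  full descents single out the longest element of a finite group and do not occur in an infinite
  one.\<close>

definition vertices :: "'a set" where
  "vertices = {x \<in> involutions G. descents x \<noteq> R}"

definition adj :: "'a \<Rightarrow> 'a \<Rightarrow> bool" where
  "adj x y \<longleftrightarrow> len (x \<otimes> y) = len x + len y"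

definition gdist :: "'a \<Rightarrow> 'a \<Rightarrow> ereal" where
  "gdist = wf_digraph.\<mu> (reduced_excess_zero_graph G R) (\<lambda>_. 1)"

lemma involution_closed: "x \<in> involutions G \<Longrightarrow> x \<in> carrier G"
  by (simp add: involutions_def)

lemma involution_inv [simp]: "x \<in> involutions G \<Longrightarrow> inv x = x"
  by (auto simp: involutions_def inv_equality)

lemma adj_sym:
  assumes "x \<in> involutions G" "y \<in> involutions G" "adj x y"
  shows "adj y x"
proof -
  have "inv (x \<otimes> y) = y \<otimes> x" using assms by (simp add: inv_mult_group involution_closed)
  then have "len (y \<otimes> x) = len (x \<otimes> y)"
    using length_inv[of "x \<otimes> y"] assms by (simp add: involution_closed)
  then show ?thesis using assms by (simp add: adj_def)
qed

text \<open>As \<open>x\<close> is an involution, \<open>x \<otimes> r\<close> is the inverse of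
  \<open>r \<otimes> x\<close> and has the same length.\<close>

lemma adj_gen:
  assumes "x \<in> involutions G" "r \<in> R" "r \<notin> descents x"
  shows "adj x r"
proof -
  have x: "x \<in> carrier G" using assms(1) involution_closed by blast
  have "inv (r \<otimes> x) = x \<otimes> r" using assms x by (simp add: inv_mult_group)
  then have "len (x \<otimes> r) = len (r \<otimes> x)" using length_inv[of "r \<otimes> x"] assms x by simp
  then show ?thesis using not_descent_length[OF x assms(2,3)] assms by (simp add: adj_def length_gen)
qed

text \<open>A common descent \<open>s\<close> cancels in \<open>x y = (x s) (s y)\<close>, where
  both factors are shorter than \<open>x\<close> and \<open>y\<close>.\<close>

lemma adj_descents:
  assumes "x \<in> involutions G" "y \<in> involutions G" "adj x y"
  shows "descents x \<inter> descents y = {}"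
proof (rule ccontr)
  assume "\<not> ?thesis"
  then obtain s where s: "s \<in> descents x" "s \<in> descents y" by blast
  then have sR: "s \<in> R" using descents_subset by blast
  have xy: "x \<in> carrier G" "y \<in> carrier G" using assms involution_closed by auto
  have "inv (s \<otimes> x) = x \<otimes> s" using assms sR xy by (simp add: inv_mult_group)
  then have "len (x \<otimes> s) = len (s \<otimes> x)" using length_inv[of "s \<otimes> x"] sR xy by simp
  moreover have "x \<otimes> y = (x \<otimes> s) \<otimes> (s \<otimes> y)" using xy sR by (simp add: m_assoc)
  ultimately have "len (x \<otimes> y) \<le> len (s \<otimes> x) + len (s \<otimes> y)"
    using length_mult_le[of "x \<otimes> s" "s \<otimes> y"] xy sR by simp
  then show False
    using descent_length[OF xy(1) s(1)] descent_length[OF xy(2) s(2)] assms(3)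
    by (simp add: adj_def)
qed

lemma descents_gen:
  assumes "r \<in> R"
  shows "descents r = {r}"
proof -
  have "s = r" if "s \<in> descents r" for s
  proof -
    have "s \<in> R" using that descents_subset by blast
    moreover have "len (s \<otimes> r) = 0" using descent_length[of r s] that assms length_gen by simp
    ultimately have "s \<otimes> r = \<one>" using length_eq_0 assms by simp
    then show "s = r" using \<open>s \<in> R\<close> assms by (metis inv_equality gen_closed inv_gen)
  qed
  then show ?thesis using descents_nonempty[of r] assms gen_neq_one by auto
qed

lemma gen_involution: "r \<in> R \<Longrightarrow> r \<in> involutions G"
  by (simp add: involutions_def gen_neq_one)

lemma gen_vertex:
  assumes "r \<in> R" "s \<in> R" "r \<noteq> s"
  shows "r \<in> vertices"
  using assms gen_involution descents_gen unfolding vertices_def by auto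

lemma adj_gens: "r \<in> R \<Longrightarrow> s \<in> R \<Longrightarrow> r \<noteq> s \<Longrightarrow> adj r s"
  using adj_gen gen_involution descents_gen by auto

lemma verts_graph:
  assumes "finite R"
  shows "verts (reduced_excess_zero_graph G R) = vertices"
proof (cases "finite (carrier G)")
  case True
  then show ?thesis
    using longest_element_iff[OF True] involution_closed
    by (auto simp: reduced_excess_zero_graph_def vertices_def induce_subgraph_def)
next
  case False
  then have "descents x \<noteq> R" if "x \<in> carrier G" for x
    using full_descents_finite[of x] that assms by blast
  then show ?thesis using False involution_closed
    by (auto simp: reduced_excess_zero_graph_def excess_zero_graph_def vertices_def)
qed

lemma arcs_graph:
  assumes "finite R"
  shows "arcs (reduced_excess_zero_graph G R) = {(x, y). x \<in> vertices \<and> y \<in> vertices \<and> adj x y}"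
proof (cases "finite (carrier G)")
  case True
  then show ?thesis
    using longest_element_iff[OF True] involution_closed
    by (auto simp: reduced_excess_zero_graph_def excess_zero_graph_def vertices_def
        induce_subgraph_def adj_def)
next
  case False
  then have "descents x \<noteq> R" if "x \<in> carrier G" for x
    using full_descents_finite[of x] that assms by blast
  then show ?thesis using False involution_closed
    by (auto simp: reduced_excess_zero_graph_def excess_zero_graph_def vertices_def adj_def)
qed

lemma tail_graph: "tail (reduced_excess_zero_graph G R) = fst"
  by (simp add: reduced_excess_zero_graph_def excess_zero_graph_def induce_subgraph_def)

lemma head_graph: "head (reduced_excess_zero_graph G R) = snd"
  by (simp add: reduced_excess_zero_graph_def excess_zero_graph_def induce_subgraph_def)

lemma gdist_le:
  assumes "pre_digraph.awalk (reduced_excess_zero_graph G R) x p y"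
  shows "gdist x y \<le> ereal (real (length p))"
proof -
  interpret wf_digraph "reduced_excess_zero_graph G R" by (rule wf_reduced_excess_zero_graph)
  show ?thesis
    using min_cost_le_walk_cost[OF assms, of "\<lambda>_. 1"]
    by (simp add: gdist_def awalk_cost_def sum_list_triv)
qed

lemma gdist_ge:
  assumes "\<And>p. pre_digraph.awalk (reduced_excess_zero_graph G R) x p y \<Longrightarrow> n \<le> length p"
  shows "ereal (real n) \<le> gdist x y"
proof -
  interpret wf_digraph "reduced_excess_zero_graph G R" by (rule wf_reduced_excess_zero_graph)
  show ?thesis
    unfolding gdist_def \<mu>_def awalk_cost_def
    by (rule INF_greatest) (use assms in \<open>auto simp: sum_list_triv\<close>)
qed

lemma awalk_graph_Nil:
  "finite R \<Longrightarrow> pre_digraph.awalk (reduced_excess_zero_graph G R) x [] y \<longleftrightarrow> x = y \<and> x \<in> vertices"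
  using verts_graph by (auto simp: pre_digraph.awalk_def pre_digraph.cas.simps)

lemma awalk_graph_Cons:
  assumes "finite R"
  shows "pre_digraph.awalk (reduced_excess_zero_graph G R) x (e # p) y \<longleftrightarrow>
    (\<exists>z. e = (x, z) \<and> x \<in> vertices \<and> z \<in> vertices \<and> adj x z \<and>
      pre_digraph.awalk (reduced_excess_zero_graph G R) z p y)"
proof -
  interpret wf_digraph "reduced_excess_zero_graph G R" by (rule wf_reduced_excess_zero_graph)
  show ?thesis
    by (cases e) (auto simp: awalk_Cons_iff arcs_graph[OF assms] tail_graph head_graph)
qed

lemmas awalk_graph = awalk_graph_Nil awalk_graph_Cons

lemma gdist_self_le:
  assumes "finite R" "x \<in> vertices"
  shows "gdist x x \<le> 0"
  using gdist_le[of x "[]" x] assms by (simp add: awalk_graph zero_ereal_def)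

lemma gdist_le_1:
  assumes "finite R" "x \<in> vertices" "y \<in> vertices" "adj x y"
  shows "gdist x y \<le> 1"
  using gdist_le[of x "[(x, y)]" y] assms by (simp add: awalk_graph one_ereal_def)

lemma gdist_le_2:
  assumes "finite R" "x \<in> vertices" "z \<in> vertices" "y \<in> vertices" "adj x z" "adj z y"
  shows "gdist x y \<le> 2"
  using gdist_le[of x "[(x, z), (z, y)]" y] assms by (simp add: awalk_graph)

lemma gdist_le_3:
  assumes "finite R" "x \<in> vertices" "z \<in> vertices" "w \<in> vertices" "y \<in> vertices"
    "adj x z" "adj z w" "adj w y"
  shows "gdist x y \<le> 3"
  using gdist_le[of x "[(x, z), (z, w), (w, y)]" y] assms by (simp add: awalk_graph)

lemma gdist_ge_1:
  assumes "finite R" "x \<noteq> y"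
  shows "1 \<le> gdist x y"
proof -
  have "1 \<le> length p" if "pre_digraph.awalk (reduced_excess_zero_graph G R) x p y" for p
    using that assms by (cases p) (auto simp: awalk_graph)
  from gdist_ge[OF this] show ?thesis by (simp add: one_ereal_def)
qed

lemma gdist_ge_2:
  assumes "finite R" "x \<noteq> y" "\<not> adj x y"
  shows "2 \<le> gdist x y"
proof -
  have "2 \<le> length p" if "pre_digraph.awalk (reduced_excess_zero_graph G R) x p y" for p
  proof (rule ccontr)
    assume "\<not> 2 \<le> length p"
    then have "length p = 0 \<or> length p = 1" by linarith
    then show False using that assms by (auto simp: awalk_graph length_Suc_conv)
  qed
  from gdist_ge[OF this] show ?thesis by simp
qed

lemma vertex_involution: "x \<in> vertices \<Longrightarrow> x \<in> involutions G"
  by (simp add: vertices_def)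

lemma vertex_not_descent:
  assumes "x \<in> vertices"
  obtains r where "r \<in> R" "r \<notin> descents x"
  using assms descents_subset[of x] unfolding vertices_def by blast

text \<open>A common neighbour \<open>z\<close> of \<open>x\<close> and \<open>y\<close> would have no descents.\<close>

lemma gdist_ge_3:
  assumes "finite R" "x \<in> vertices" "y \<in> vertices" "\<not> adj x y" "descents x \<union> descents y = R"
  shows "3 \<le> gdist x y"
proof -
  have neq: "x \<noteq> y" using assms(2,5) by (auto simp: vertices_def)
  have no_common: False if z: "z \<in> vertices" "adj x z" "adj z y" for z
  proof -
    have zi: "z \<in> involutions G" using z vertex_involution by blast
    have "descents x \<inter> descents z = {}" "descents z \<inter> descents y = {}"
      using adj_descents z assms(2,3) vertex_involution by blast+
    then have "descents z = {}" using assms(5) descents_subset[of z] by blast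
    then show False using zi descents_nonempty[of z] by (simp add: involutions_def)
  qed
  have "3 \<le> length p" if p: "pre_digraph.awalk (reduced_excess_zero_graph G R) x p y" for p
  proof (rule ccontr)
    assume "\<not> 3 \<le> length p"
    then have "length p = 0 \<or> length p = 1 \<or> length p = 2" by linarith
    then show False using p assms(1,4) neq no_common
      by (auto simp: awalk_graph length_Suc_conv numeral_2_eq_2)
  qed
  from gdist_ge[OF this] show ?thesis by simp
qed

lemma graph_diam_eqI:
  assumes "finite R" "\<And>x y. x \<in> vertices \<Longrightarrow> y \<in> vertices \<Longrightarrow> gdist x y \<le> c"
    and "x \<in> vertices" "y \<in> vertices" "c \<le> gdist x y"
  shows "graph_diam (reduced_excess_zero_graph G R) = c"
proof -
  have eq: "graph_diam (reduced_excess_zero_graph G R) = (SUP x\<in>vertices. SUP y\<in>vertices. gdist x y)"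
    by (simp add: graph_diam_def verts_graph[OF assms(1)] gdist_def)
  show ?thesis unfolding eq
  proof (rule antisym)
    show "(SUP x\<in>vertices. SUP y\<in>vertices. gdist x y) \<le> c"
      by (intro SUP_least assms(2))
    show "c \<le> (SUP x\<in>vertices. SUP y\<in>vertices. gdist x y)"
      by (rule SUP_upper2[OF assms(3)], rule SUP_upper2[OF assms(4)], rule assms(5))
  qed
qed

lemma gdist_le_3_vertices:
  assumes "finite R" "2 \<le> card R" "x \<in> vertices" "y \<in> vertices"
  shows "gdist x y \<le> 3"
proof -
  obtain r where r: "r \<in> R" "r \<notin> descents x" using vertex_not_descent assms(3) by blast
  obtain s where s: "s \<in> R" "s \<notin> descents y" using vertex_not_descent assms(4) by blast
  have xr: "adj x r" using adj_gen r assms(3) vertex_involution by blast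
  have "adj y s" using adj_gen s assms(4) vertex_involution by blast
  then have sy: "adj s y" using adj_sym s assms(4) vertex_involution gen_involution by blast
  have vert: "t \<in> vertices" if "t \<in> R" for t
  proof -
    have "R - {t} \<noteq> {}" using assms(2) that by (auto simp: subset_singleton_iff)
    then show ?thesis using gen_vertex that by blast
  qed
  show ?thesis
  \<comment> \<open>If both choices agree, the path shrinks to \<open>x\<close>, \<open>r\<close>,
    \<open>y\<close>.\<close>
  proof (cases "r = s")
    case True
    then have "gdist x y \<le> 2" using gdist_le_2[of x r y] assms vert r xr sy by blast
    also have "2 \<le> (3::ereal)" by simp
    finally show ?thesis .
  next
    case False
    then show ?thesis using gdist_le_3[of x r s y] assms vert r s xr sy adj_gens by blast
  qed
qed

lemma graph_diam_3:
  assumes "finite R" "2 \<le> card R" "x \<in> vertices" "y \<in> vertices" "\<not> adj x y"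
    "descents x \<union> descents y = R"
  shows "graph_diam (reduced_excess_zero_graph G R) = 3"
  using graph_diam_eqI[of 3 x y] gdist_le_3_vertices gdist_ge_3 assms by blast

text \<open>The longest elements of the two subgroups have descent sets \<open>J\<close> and
  \<open>K\<close>: the overlap forbids adjacency, and the covering of \<open>R\<close> forbids a
  common neighbour.\<close>

lemma graph_diam_3_parabolic:
  assumes "finite R" "J \<subset> R" "K \<subset> R" "J \<union> K = R" "J \<inter> K \<noteq> {}"
    and "finite (generate G J)" "finite (generate G K)"
  shows "graph_diam (reduced_excess_zero_graph G R) = 3"
proof -
  have "J \<noteq> {}" "K \<noteq> {}" using assms(5) by auto
  obtain x where x: "x \<in> involutions G" "descents x = J"
    by (rule parabolic_involution[of J]) (use assms in auto)
  obtain y where y: "y \<in> involutions G" "descents y = K"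
    by (rule parabolic_involution[of K]) (use assms in auto)
  have "\<not> adj x y" using adj_descents x y assms(5) by blast
  moreover have "2 \<le> card R"
  proof -
    have "0 < card J" using assms(1,2,5) by (auto simp: card_gt_0_iff intro: finite_subset)
    moreover have "card J < card R" using assms(1,2) by (rule psubset_card_mono)
    ultimately show ?thesis by linarith
  qed
  ultimately show ?thesis
    using graph_diam_3[of x y] x y assms unfolding vertices_def by blast
qed

section \<open>Coxeter matrix entries and dihedral subgroups\<close>

lemma coxeter_m_sym:
  assumes "r \<in> R" "s \<in> R"
  shows "coxeter_m G s r = coxeter_m G r s"
proof -
  have "inv (r \<otimes> s) = s \<otimes> r" using assms by (simp add: inv_mult_group)
  then show ?thesis using ord_inv[of "r \<otimes> s"] assms by (simp add: coxeter_m_def)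
qed

lemma coxeter_m_eq_1_iff:
  assumes "r \<in> R" "s \<in> R"
  shows "coxeter_m G r s = 1 \<longleftrightarrow> r = s"
proof -
  have "coxeter_m G r s = 1 \<longleftrightarrow> r \<otimes> s = \<one>"
    unfolding coxeter_m_def using assms by (intro ord_eq_1) simp
  also have "\<dots> \<longleftrightarrow> r = s" using assms by (metis gen_sq gen_closed inv_equality inv_gen)
  finally show ?thesis .
qed

lemma coxeter_m_2_commute:
  assumes "r \<in> R" "s \<in> R" "coxeter_m G r s = 2"
  shows "r \<otimes> s = s \<otimes> r"
proof -
  have "(r \<otimes> s) [^] (2::nat) = \<one>"
    using pow_eq_id[of "r \<otimes> s" 2] assms unfolding coxeter_m_def by simp
  then have "(r \<otimes> s) \<otimes> (r \<otimes> s) = \<one>" using assms by (simp add: numeral_2_eq_2)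
  then have "inv (r \<otimes> s) = r \<otimes> s" using assms by (intro inv_equality) auto
  then show ?thesis using assms by (simp add: inv_mult_group)
qed

lemma coxeter_m_3_braid:
  assumes "r \<in> R" "s \<in> R" "coxeter_m G r s = 3"
  shows "r \<otimes> (s \<otimes> r) = s \<otimes> (r \<otimes> s)"
proof -
  have "(r \<otimes> s) [^] (3::nat) = \<one>"
    using pow_eq_id[of "r \<otimes> s" 3] assms unfolding coxeter_m_def by simp
  then have "(r \<otimes> (s \<otimes> r)) \<otimes> (s \<otimes> (r \<otimes> s)) = \<one>"
    using assms by (simp add: numeral_3_eq_3 m_assoc)
  then have "inv (s \<otimes> (r \<otimes> s)) = r \<otimes> (s \<otimes> r)" using assms by (intro inv_equality) auto
  then show ?thesis using assms by (simp add: inv_mult_group m_assoc)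
qed

text \<open>The reflections \<open>(r s)^i r\<close> with \<open>i < k\<close> are distinct as long
  as \<open>k\<close> does not exceed the order of \<open>r s\<close>, and distinct reflections make
  the word reduced.\<close>

lemma length_alt_word:
  assumes "r \<in> R" "s \<in> R" "coxeter_m G r s = 0 \<or> k \<le> coxeter_m G r s"
  shows "len (wp (alt r s k)) = k"
proof -
  have rs: "r \<otimes> s \<in> carrier G" using assms by simp
  have aux: False if ij: "i < j" "j < k" "(r \<otimes> s) [^] i \<otimes> r = (r \<otimes> s) [^] j \<otimes> r" for i j :: nat
  proof -
    have "(r \<otimes> s) [^] j = (r \<otimes> s) [^] i" using ij(3) assms rs by simp
    moreover have "(r \<otimes> s) [^] j = (r \<otimes> s) [^] i \<otimes> (r \<otimes> s) [^] (j - i)"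
      using ij(1) rs by (simp add: nat_pow_mult)
    ultimately have "(r \<otimes> s) [^] (j - i) = \<one>"
      using rs by (metis l_cancel_one' nat_pow_closed)
    then have "coxeter_m G r s dvd j - i" using pow_eq_id[OF rs] unfolding coxeter_m_def by simp
    then show False using ij assms(3) by (cases "coxeter_m G r s = 0") (auto dest!: dvd_imp_le)
  qed
  have "distinct (refls (alt r s k))"
    using assms(1,2) aux by (auto simp: refls_alt distinct_map inj_on_def) (metis linorder_neqE_nat)
  then show ?thesis
    using distinct_refls_reduced[of "alt r s k"] alt_in_lists[of r R s k] assms by simp
qed

text \<open>An alternating word of odd length is a palindrome, hence its own inverse, and its first
  letter is a descent.\<close>

lemma alt_odd_involution:
  assumes "r \<in> R" "s \<in> R" "coxeter_m G r s = 0 \<or> Suc (2 * i) \<le> coxeter_m G r s"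
  defines "x \<equiv> wp (alt r s (Suc (2 * i)))"
  shows "x \<in> involutions G" "len x = Suc (2 * i)" "r \<in> descents x"
proof -
  show l: "len x = Suc (2 * i)" unfolding x_def by (rule length_alt_word[OF assms(1-3)])
  have x: "x = (r \<otimes> s) [^] i \<otimes> r" unfolding x_def by (rule word_prod_alt_odd[OF assms(1,2)])
  have xc: "x \<in> carrier G" using x assms by simp
  have "inv ((r \<otimes> s) [^] i) = inv (r \<otimes> s) [^] i" using assms(1,2) by (simp add: nat_pow_inv)
  also have "inv (r \<otimes> s) = s \<otimes> r" using assms(1,2) by (simp add: inv_mult_group)
  finally have "inv x = r \<otimes> (s \<otimes> r) [^] i" using x assms(1,2) by (simp add: inv_mult_group)
  then have "inv x = x" using x pow_shift assms(1,2) by simp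
  then have "x \<otimes> x = \<one>" using xc by (metis l_inv)
  moreover have "x \<noteq> \<one>" using l by auto
  ultimately show "x \<in> involutions G" using xc by (simp add: involutions_def)
  have al: "alt s r (2 * i) \<in> lists R" by (rule alt_in_lists[OF assms(2,1)])
  then have "r \<otimes> x = wp (alt s r (2 * i))" unfolding x_def using assms(1) by simp
  then have "len (r \<otimes> x) \<le> 2 * i" using length_le_word[OF al] by simp
  then show "r \<in> descents x" using l assms(1) by (simp add: descents_def)
qed

section \<open>Rank two\<close>

text \<open>The extremal pair consists of the two alternating words of the largest odd length below
  \<open>m\<close>, one starting with \<open>r\<close>, the other with \<open>s\<close>. Their
  descents cover \<open>R\<close>, but their product is a rotation that also has a short word in the
  opposite direction.\<close>

lemma graph_diam_dihedral:
  assumes R: "R = {r, s}" "r \<noteq> s" and m: "4 \<le> coxeter_m G r s"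
  shows "graph_diam (reduced_excess_zero_graph G R) = 3"
proof -
  let ?m = "coxeter_m G r s"
  \<comment> \<open>\<open>2 * i + 1\<close> is the largest odd number below \<open>m\<close>. The
    bound \<open>m < 4 * i + 2\<close> fails for \<open>m = 2\<close> and \<open>m = 3\<close>,
    where \<open>i\<close> would be 0.\<close>
  define i where "i = (?m - 2) div 2"
  have i: "Suc (2 * i) < ?m" "?m < 4 * i + 2"
    using m unfolding i_def by presburger+
  have rs: "r \<in> R" "s \<in> R" using R by auto
  have rsc: "r \<otimes> s \<in> carrier G" using rs by simp
  have msr: "coxeter_m G s r = ?m" by (rule coxeter_m_sym[OF rs])
  define x where "x = wp (alt r s (Suc (2 * i)))"
  define y where "y = wp (alt s r (Suc (2 * i)))"
  have x: "x \<in> involutions G" "len x = Suc (2 * i)" "r \<in> descents x"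
    using alt_odd_involution[of r s i] rs i unfolding x_def by auto
  have y: "y \<in> involutions G" "len y = Suc (2 * i)" "s \<in> descents y"
    using alt_odd_involution[of s r i] rs i msr unfolding y_def by auto
  have xc: "x \<in> carrier G" "y \<in> carrier G" using x y involution_closed by auto
  \<comment> \<open>An element with full descents would be at least as long as this one, while
    \<open>x\<close> and \<open>y\<close> have length below \<open>m\<close>.\<close>
  have long: "len (wp (alt r s ?m)) = ?m" "wp (alt r s ?m) \<in> carrier G"
    using length_alt_word[OF rs, of ?m] alt_in_lists[of r R s ?m] rs by auto
  then have "descents x \<noteq> R" "descents y \<noteq> R"
    using full_descents_length(1)[OF _ _ long(2)] xc x(2) y(2) i(1) by fastforce+
  then have v: "x \<in> vertices" "y \<in> vertices" using x y by (auto simp: vertices_def)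
  have "\<not> adj x y"
  proof
    assume "adj x y"
    have "x \<otimes> y = (r \<otimes> s) [^] i \<otimes> (r \<otimes> (s \<otimes> r) [^] i) \<otimes> s"
      unfolding x_def y_def using rs by (simp add: word_prod_alt_odd m_assoc del: alt.simps)
    also have "\<dots> = (r \<otimes> s) [^] i \<otimes> (r \<otimes> s) [^] Suc i"
      unfolding pow_shift[OF rs] using rs by (simp add: m_assoc)
    also have "\<dots> = (r \<otimes> s) [^] (2 * i + 1)"
      unfolding nat_pow_mult[OF rsc] by (simp add: mult_2)
    finally have xy: "x \<otimes> y = (r \<otimes> s) [^] (2 * i + 1)" .
    \<comment> \<open>Going round the other way: \<open>(r s)^k\<close> is the inverse of
      \<open>x y\<close>, so \<open>x y\<close> has length at most \<open>2 * k\<close>.\<close>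
    define k where "k = ?m - (2 * i + 1)"
    have "(r \<otimes> s) [^] k \<otimes> (x \<otimes> y) = (r \<otimes> s) [^] ?m"
      unfolding xy nat_pow_mult[OF rsc] using i(1) by (simp add: k_def)
    also have "\<dots> = \<one>" unfolding coxeter_m_def using rsc by simp
    finally have "inv (x \<otimes> y) = (r \<otimes> s) [^] k" using xc rsc by (intro inv_equality) auto
    then have "len (x \<otimes> y) = len ((r \<otimes> s) [^] k)" using length_inv[of "x \<otimes> y"] xc by simp
    also have "\<dots> \<le> 2 * k"
      using length_le_word[of "alt r s (2 * k)"] alt_in_lists[of r R s] rs
      by (simp add: word_prod_alt_even)
    also have "\<dots> < 4 * i + 2" using i by (simp add: k_def)
    finally show False using \<open>adj x y\<close> x(2) y(2) by (simp add: adj_def)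
  qed
  moreover have "descents x \<union> descents y = R"
    using x(3) y(3) descents_subset[of x] descents_subset[of y] R by auto
  moreover have "finite R" "2 \<le> card R" using R by auto
  ultimately show ?thesis using graph_diam_3 v by blast
qed

text \<open>Descents \<open>a\<close>, \<open>b\<close> and, for label 3, again \<open>a\<close> are
  split off from \<open>x\<close>. The relation \<open>a b = b a\<close> or
  \<open>a b a = b a b\<close> then brings \<open>b\<close> to the front, against the choice of
  \<open>b\<close> as a non-descent.\<close>

lemma vertex_small_dihedral:
  assumes R: "R = {r, s}" "r \<noteq> s" and m: "coxeter_m G r s = 2 \<or> coxeter_m G r s = 3"
    and x: "x \<in> vertices"
  shows "x \<in> R"
proof (rule ccontr)
  assume xR: "x \<notin> R"
  have xi: "x \<in> involutions G" "x \<in> carrier G" "x \<noteq> \<one>" "x \<otimes> x = \<one>"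
    using x by (auto simp: vertices_def involutions_def)
  obtain b where b: "b \<in> R" "b \<notin> descents x" by (rule vertex_not_descent[OF x])
  obtain a where a: "a \<in> descents x" using descents_nonempty xi by blast
  have aR: "a \<in> R" using a descents_subset by blast
  have ab: "a \<noteq> b" "R = {a, b}" using a b aR R by auto
  have mab: "coxeter_m G a b = coxeter_m G r s"
    using ab R coxeter_m_sym[of r s] by (auto simp: doubleton_eq_iff)
  define x1 where "x1 = a \<otimes> x"
  have x1: "x1 \<in> carrier G" "x = a \<otimes> x1" "Suc (len x1) = len x"
    using descent_length[OF xi(2) a] aR xi unfolding x1_def by auto
  have "x1 \<noteq> \<one>" using x1(2) aR xR by auto
  moreover have "a \<notin> descents x1" using x1 by (auto simp: descents_def)
  ultimately have b1: "b \<in> descents x1"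
    using descents_nonempty[OF x1(1)] descents_subset[of x1] ab(2) by auto
  define x2 where "x2 = b \<otimes> x1"
  have x2: "x2 \<in> carrier G" "x1 = b \<otimes> x2" "Suc (len x2) = len x1"
    using descent_length[OF x1(1) b1] b x1 unfolding x2_def by auto
  have big: "len (b \<otimes> x) = Suc (len x)" by (rule not_descent_length[OF xi(2) b])
  show False
  proof (cases "coxeter_m G r s = 2")
    case True
    then have "a \<otimes> b = b \<otimes> a" using coxeter_m_2_commute aR b mab by simp
    then have "x = b \<otimes> (a \<otimes> x2)" using x1 x2 aR b by (simp flip: m_assoc)
    then have "b \<otimes> x = a \<otimes> x2" using x2 aR b by simp
    then have "len (b \<otimes> x) \<le> Suc (len x2)"
      using length_mult_le[of a x2] aR x2 length_gen by simp
    then show False using big x1 x2 by simp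
  next
    case False
    then have m3: "coxeter_m G a b = 3" using m mab by simp
    \<comment> \<open>Otherwise \<open>x = a b\<close>, which has order three and is no
      involution.\<close>
    have "x2 \<noteq> \<one>"
    proof
      assume "x2 = \<one>"
      then have "x = a \<otimes> b" using x1 x2 b by simp
      then have "(a \<otimes> b) [^] (2::nat) = \<one>" using xi by (simp add: numeral_2_eq_2)
      then have "coxeter_m G a b dvd 2"
        using pow_eq_id[of "a \<otimes> b" 2] aR b unfolding coxeter_m_def by simp
      then show False using m3 by (auto dest: dvd_imp_le)
    qed
    moreover have "b \<notin> descents x2" using x2 by (auto simp: descents_def)
    ultimately have a2: "a \<in> descents x2"
      using descents_nonempty[OF x2(1)] descents_subset[of x2] ab(2) by auto
    define x3 where "x3 = a \<otimes> x2"
    have x3: "x3 \<in> carrier G" "x2 = a \<otimes> x3" "Suc (len x3) = len x2"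
      using descent_length[OF x2(1) a2] aR x2 unfolding x3_def by auto
    have "x = (a \<otimes> (b \<otimes> a)) \<otimes> x3" using x1 x2 x3 aR b by (simp add: m_assoc)
    also have "\<dots> = (b \<otimes> (a \<otimes> b)) \<otimes> x3" using coxeter_m_3_braid[of a b] m3 aR b by simp
    finally have "b \<otimes> x = (a \<otimes> b) \<otimes> x3" using x3 aR b by (simp add: m_assoc)
    then have "len (b \<otimes> x) \<le> len (a \<otimes> b) + len x3"
      using length_mult_le[of "a \<otimes> b" x3] aR b x3 by simp
    also have "len (a \<otimes> b) \<le> 2" using length_mult_le[of a b] aR b length_gen by simp
    finally show False using big x1 x2 x3 by simp
  qed
qed

lemma graph_diam_small_dihedral:
  assumes R: "R = {r, s}" "r \<noteq> s" and m: "coxeter_m G r s = 2 \<or> coxeter_m G r s = 3"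
  shows "graph_diam (reduced_excess_zero_graph G R) = 1"
proof (rule graph_diam_eqI)
  show f: "finite R" using R by simp
  show "r \<in> vertices" "s \<in> vertices" using gen_vertex[of r s] gen_vertex[of s r] R by auto
  show "1 \<le> gdist r s" by (rule gdist_ge_1[OF f R(2)])
  fix x y assume xy: "x \<in> vertices" "y \<in> vertices"
  then have "x \<in> R" "y \<in> R" using vertex_small_dihedral[OF R m] by auto
  then show "gdist x y \<le> 1"
    using gdist_self_le[OF f xy(1)] gdist_le_1[OF f xy] adj_gens[of x y]
    by (cases "x = y") (auto intro: order_trans)
qed

text \<open>Without full descents every non-identity element has exactly one descent. The first
  letter \<open>c\<close> of \<open>y\<close> is moved to the end of \<open>w\<close>: then
  \<open>c\<close> is the only descent of \<open>inv (w \<otimes> c)\<close> and no descent of the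
  rest of \<open>y\<close>, so the induction continues.\<close>

lemma adj_disjoint_descents_rank_2:
  assumes R: "R = {r, s}" and inf: "\<And>x. x \<in> carrier G \<Longrightarrow> descents x \<noteq> R"
  shows "y \<in> carrier G \<Longrightarrow> w \<in> carrier G \<Longrightarrow> descents y \<inter> descents (inv w) = {} \<Longrightarrow>
    len (w \<otimes> y) = len w + len y"
proof (induction "len y" arbitrary: y w rule: less_induct)
  case less
  show ?case
  proof (cases "y = \<one>")
    case False
    then obtain c where c: "c \<in> descents y" using descents_nonempty less.prems by blast
    have cR: "c \<in> R" using c descents_subset by blast
    define y1 where "y1 = c \<otimes> y"
    have y1: "y1 \<in> carrier G" "y = c \<otimes> y1" "Suc (len y1) = len y"
      using descent_length[OF less.prems(1) c] cR less.prems unfolding y1_def by auto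
    have cw: "c \<notin> descents (inv w)" using c less.prems by blast
    have i1: "inv (w \<otimes> c) = c \<otimes> inv w" using cR less.prems by (simp add: inv_mult_group)
    have lw: "len (c \<otimes> inv w) = Suc (len w)"
      using not_descent_length[OF _ cR cw] less.prems by simp
    then have "len (w \<otimes> c) = Suc (len w)"
      using length_inv[of "w \<otimes> c"] i1 cR less.prems by simp
    moreover have "c \<in> descents (c \<otimes> inv w)" using lw cR less.prems by (simp add: descents_def)
    then have "descents (c \<otimes> inv w) \<subseteq> {c}"
      using inf[of "c \<otimes> inv w"] descents_subset[of "c \<otimes> inv w"] R cR less.prems by auto
    moreover have "c \<notin> descents y1" using y1 by (auto simp: descents_def)
    ultimately have "len ((w \<otimes> c) \<otimes> y1) = Suc (len w) + len y1"
      using less.hyps[of y1 "w \<otimes> c"] y1 cR less.prems i1 by auto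
    then show ?thesis using y1 cR less.prems by (simp add: m_assoc)
  qed (use less.prems in simp)
qed

text \<open>Vertices with disjoint descents are adjacent; two vertices sharing their only descent
  \<open>a\<close> have the other generator as a common neighbour. The pair \<open>r\<close>,
  \<open>r s r\<close> shares the descent \<open>r\<close> and attains distance 2.\<close>

lemma graph_diam_infinite_dihedral:
  assumes R: "R = {r, s}" "r \<noteq> s" and m: "coxeter_m G r s = 0"
  shows "infinite (carrier G)" "graph_diam (reduced_excess_zero_graph G R) = 2"
proof -
  have rs: "r \<in> R" "s \<in> R" using R by auto
  have f: "finite R" using R by simp
  \<comment> \<open>Alternating words of every length are reduced, so no element is longest.\<close>
  have inf: "descents x \<noteq> R" if "x \<in> carrier G" for x
  proof
    assume "descents x = R"
    moreover have "wp (alt r s (Suc (len x))) \<in> carrier G"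
      using alt_in_lists[of r R s] rs by (simp del: alt.simps)
    ultimately have "len (wp (alt r s (Suc (len x)))) \<le> len x"
      using full_descents_length(1) that by blast
    then show False using length_alt_word[OF rs] m by (simp del: alt.simps)
  qed
  show infG: "infinite (carrier G)"
  proof
    assume fG: "finite (carrier G)"
    obtain x where "x \<in> generate G R" "R \<subseteq> descents x"
      by (rule ex_full_descents[of R]) (use gens_generate fG in auto)
    then show False using inf[of x] gens_generate descents_subset[of x] by auto
  qed
  define y where "y = wp (alt r s (Suc (2 * 1)))"
  have y: "y \<in> involutions G" "len y = 3" "r \<in> descents y"
    using alt_odd_involution[of r s 1] rs m unfolding y_def by auto
  show "graph_diam (reduced_excess_zero_graph G R) = 2"
  proof (rule graph_diam_eqI[OF f])
    show r: "r \<in> vertices" using gen_vertex[of r s] R by auto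
    show yv: "y \<in> vertices" using y inf involution_closed by (simp add: vertices_def)
    have "r \<noteq> y" using y length_gen[OF rs(1)] by auto
    moreover have "\<not> adj r y" using adj_descents[of r y] gen_involution[OF rs(1)] y descents_gen[OF rs(1)] by auto
    ultimately show "2 \<le> gdist r y" by (rule gdist_ge_2[OF f])
    fix x z assume xz: "x \<in> vertices" "z \<in> vertices"
    then have i: "x \<in> involutions G" "z \<in> involutions G" by (auto simp: vertices_def)
    then have c: "x \<in> carrier G" "z \<in> carrier G" using involution_closed by auto
    show "gdist x z \<le> 2"
    proof (cases "descents x \<inter> descents z = {}")
      case True
      then have "adj x z"
        using adj_disjoint_descents_rank_2[OF R(1) inf c(2,1)] i by (auto simp: adj_def)
      then have "gdist x z \<le> 1" using gdist_le_1[OF f xz] by blast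
      also have "1 \<le> (2::ereal)" by simp
      finally show ?thesis .
    next
      case False
      then obtain a where a: "a \<in> descents x" "a \<in> descents z" by blast
      obtain b where b: "b \<in> R" "b \<notin> descents x" using vertex_not_descent[OF xz(1)] by blast
      have aR: "a \<in> R" using a descents_subset by blast
      then have ab: "R = {a, b}" "a \<noteq> b" using a b R by auto
      then have bz: "b \<notin> descents z" using inf[OF c(2)] descents_subset[of z] a by auto
      have "adj x b" "adj b z"
        using adj_gen[OF i(1) b] adj_sym[OF i(2) gen_involution[OF b(1)] adj_gen[OF i(2) b(1) bz]] by auto
      moreover have "b \<in> vertices" using gen_vertex[OF b(1) aR] ab by auto
      ultimately show ?thesis using gdist_le_2[OF f xz(1) _ xz(2)] by blast
    qed
  qed
qed

lemma graph_diam_finite_maximal_parabolics: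
  assumes "finite R" "3 \<le> card R" "\<And>J. J \<subset> R \<Longrightarrow> finite (generate G J)"
  shows "graph_diam (reduced_excess_zero_graph G R) = 3"
proof -
  obtain T where "T \<subseteq> R" "card T = 3" "finite T" by (rule obtain_subset_with_card_n[OF assms(2)])
  then obtain r s t where "r \<in> R" "s \<in> R" "t \<in> R" "r \<noteq> s" "r \<noteq> t" "s \<noteq> t"
    by (auto simp: card_3_iff)
  then show ?thesis
    \<comment> \<open>The third generator \<open>t\<close> lies in both complements.\<close>
    by (intro graph_diam_3_parabolic[of "R - {r}" "R - {s}"] assms) auto
qed

section \<open>Finite parabolic subgroups\<close>

text \<open>Words over \<open>J\<close> act on \<open>S\<close> by right multiplication, so
  \<open>S\<close> contains the orbit of the identity, which is the whole subgroup.\<close>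

lemma finite_generateI:
  assumes "J \<subseteq> R" "finite S" "S \<subseteq> carrier G" "\<one> \<in> S"
    and "\<And>x s. x \<in> S \<Longrightarrow> s \<in> J \<Longrightarrow> x \<otimes> s \<in> S"
  shows "finite (generate G J)"
proof (rule finite_subset[OF _ assms(2)])
  have step: "x \<otimes> wp ws \<in> S" if "ws \<in> lists J" "x \<in> S" for ws x
    using that
  proof (induction ws arbitrary: x)
    case (Cons s ws)
    then have "ws \<in> lists R" "s \<in> R" "x \<in> carrier G" using assms(1,3) by auto
    moreover have "(x \<otimes> s) \<otimes> wp ws \<in> S" using Cons assms(5) by simp
    ultimately show ?case by (simp add: m_assoc)
  qed (use assms(3) in auto)
  show "generate G J \<subseteq> S"
  proof
    fix x assume "x \<in> generate G J"
    then obtain ws where ws: "ws \<in> lists J" "wp ws = x" by (rule generate_words[OF assms(1)])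
    then have "x \<in> carrier G" using assms(1) word_prod_closed[of ws] by auto
    then show "x \<in> S" using step[OF ws(1) assms(4)] ws(2) by simp
  qed
qed

text \<open>The rotations \<open>(r s)^k\<close> and the reflections \<open>(r s)^k r\<close> form a
  finite set closed under right multiplication by \<open>r\<close> and \<open>s\<close>.\<close>

lemma finite_generate_dihedral:
  assumes "r \<in> R" "s \<in> R" "coxeter_m G r s \<noteq> 0"
  shows "finite (generate G {r, s})"
proof -
  let ?m = "coxeter_m G r s"
  let ?T = "range (\<lambda>k::nat. (r \<otimes> s) [^] k)"
  have rs: "r \<otimes> s \<in> carrier G" using assms by simp
  have "?T = {(r \<otimes> s) [^] k | k. k \<in> (UNIV :: nat set)}" by auto
  also have "\<dots> = {(r \<otimes> s) [^] k | k. k \<in> {0 .. ord (r \<otimes> s) - 1}}"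
    using ord_elems_inf_carrier[OF rs] assms(3) unfolding coxeter_m_def by simp
  finally have finT: "finite ?T" by simp
  \<comment> \<open>Expresses the inverse rotation with a natural exponent.\<close>
  have m1: "s \<otimes> r = (r \<otimes> s) [^] (?m - 1)"
  proof -
    have "(r \<otimes> s) [^] (?m - 1) \<otimes> (r \<otimes> s) = (r \<otimes> s) [^] Suc (?m - 1)" by simp
    also have "\<dots> = \<one>" using assms(3) rs unfolding coxeter_m_def by simp
    finally have "inv (r \<otimes> s) = (r \<otimes> s) [^] (?m - 1)" using rs by (intro inv_equality) auto
    then show ?thesis using assms by (simp add: inv_mult_group)
  qed
  show ?thesis
  proof (rule finite_generateI[where S = "?T \<union> (\<lambda>x. x \<otimes> r) ` ?T"])
    show "\<one> \<in> ?T \<union> (\<lambda>x. x \<otimes> r) ` ?T" by (auto intro: range_eqI[of _ _ 0])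
    fix x t assume x: "x \<in> ?T \<union> (\<lambda>x. x \<otimes> r) ` ?T" and t: "t \<in> {r, s}"
    show "x \<otimes> t \<in> ?T \<union> (\<lambda>x. x \<otimes> r) ` ?T"
    proof (cases "x \<in> ?T")
      case True
      then obtain k where k: "x = (r \<otimes> s) [^] (k::nat)" by auto
      have "x \<otimes> s = (x \<otimes> (s \<otimes> r)) \<otimes> r" using k assms by (simp add: m_assoc)
      also have "x \<otimes> (s \<otimes> r) = (r \<otimes> s) [^] (k + (?m - 1))"
        unfolding k m1 using rs by (simp add: nat_pow_mult)
      finally have "x \<otimes> s \<in> (\<lambda>x. x \<otimes> r) ` ?T" by blast
      then show ?thesis using True t by blast
    next
      case False
      then obtain k where k: "x = (r \<otimes> s) [^] (k::nat) \<otimes> r" using x by auto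
      have "x \<otimes> r = (r \<otimes> s) [^] k" "x \<otimes> s = (r \<otimes> s) [^] Suc k"
        unfolding k using assms by (simp_all add: m_assoc)
      then show ?thesis using t by blast
    qed
  qed (use assms finT in auto)
qed

text \<open>Since \<open>k\<close> commutes with \<open>J\<close>, the two cosets \<open><J>\<close>
  and \<open><J> k\<close> are closed under right multiplication by all generators.\<close>

lemma finite_generate_insert:
  assumes "J \<subseteq> R" "k \<in> R" "\<And>j. j \<in> J \<Longrightarrow> coxeter_m G k j = 2" "finite (generate G J)"
  shows "finite (generate G (insert k J))"
proof (rule finite_generateI[where S = "generate G J \<union> (\<lambda>x. x \<otimes> k) ` generate G J"])
  have c: "generate G J \<subseteq> carrier G" using generate_closed[OF assms(1)] by blast
  show "generate G J \<union> (\<lambda>x. x \<otimes> k) ` generate G J \<subseteq> carrier G" using c assms(2) by auto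
  show "\<one> \<in> generate G J \<union> (\<lambda>x. x \<otimes> k) ` generate G J" by (simp add: generate.one)
  fix x s assume x: "x \<in> generate G J \<union> (\<lambda>x. x \<otimes> k) ` generate G J" and s: "s \<in> insert k J"
  have mult: "y \<otimes> j \<in> generate G J" if "y \<in> generate G J" "j \<in> J" for y j
    using generate.eng[OF that(1) generate.incl[OF that(2)]] .
  from x show "x \<otimes> s \<in> generate G J \<union> (\<lambda>x. x \<otimes> k) ` generate G J"
  proof
    assume "x \<in> (\<lambda>x. x \<otimes> k) ` generate G J"
    then obtain y where y: "y \<in> generate G J" "x = y \<otimes> k" by blast
    have yc: "y \<in> carrier G" using y c by blast
    show ?thesis
    proof (cases "s = k")
      case True
      then have "x \<otimes> s = y" using y yc assms(2) by (simp add: m_assoc)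
      then show ?thesis using y by blast
    next
      case False
      then have sJ: "s \<in> J" "s \<in> R" using s assms(1) by auto
      then have "k \<otimes> s = s \<otimes> k" using coxeter_m_2_commute assms(2,3) by blast
      then have "x \<otimes> s = (y \<otimes> s) \<otimes> k" using y yc assms(2) sJ by (simp add: m_assoc)
      then show ?thesis using mult[OF y(1) sJ(1)] by blast
    qed
  qed (use s mult in auto)
qed (use assms in auto)

lemma finite_generate_union:
  assumes "finite A" "A \<union> J \<subseteq> R" "finite (generate G J)"
    and "\<And>a b. a \<in> A \<Longrightarrow> b \<in> A \<union> J \<Longrightarrow> a \<noteq> b \<Longrightarrow> coxeter_m G a b = 2" "A \<inter> J = {}"
  shows "finite (generate G (A \<union> J))"
  using assms
proof (induction A)
  case (insert a A)
  have "finite (generate G (A \<union> J))" using insert by auto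
  then have "finite (generate G (insert a (A \<union> J)))"
    using insert by (intro finite_generate_insert) auto
  then show ?case by simp
qed simp

text \<open>Coset enumeration: with \<open>H = \<langle>a, v\<rangle>\<close> the four cosets \<open>H\<close>, \<open>H b\<close>, \<open>H b v\<close>, \<open>H b v a\<close> are
  permuted by right multiplication.\<close>

lemma finite_generate_A3:
  assumes "a \<in> R" "v \<in> R" "b \<in> R"
    and "coxeter_m G a v = 3" "coxeter_m G v b = 3" "coxeter_m G a b = 2"
  shows "finite (generate G {a, v, b})"
proof -
  let ?H = "generate G {a, v}"
  let ?S = "?H \<union> (\<lambda>h. h \<otimes> b) ` ?H \<union> (\<lambda>h. h \<otimes> (b \<otimes> v)) ` ?H \<union> (\<lambda>h. h \<otimes> (b \<otimes> (v \<otimes> a))) ` ?H"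
  have H: "finite ?H" using finite_generate_dihedral assms by simp
  have hc: "h \<in> carrier G" if "h \<in> ?H" for h using that generate_closed[of "{a, v}"] assms by auto
  have mult: "h \<otimes> t \<in> ?H" if "h \<in> ?H" "t \<in> {a, v}" for h t
    by (rule generate.eng[OF that(1) generate.incl[OF that(2)]])
  have ab: "a \<otimes> b = b \<otimes> a" by (rule coxeter_m_2_commute[OF assms(1,3,6)])
  have av: "a \<otimes> (v \<otimes> a) = v \<otimes> (a \<otimes> v)" by (rule coxeter_m_3_braid[OF assms(1,2,4)])
  have vb: "v \<otimes> (b \<otimes> v) = b \<otimes> (v \<otimes> b)" by (rule coxeter_m_3_braid[OF assms(2,3,5)])
  have c0: "h \<otimes> t \<in> ?S" if "h \<in> ?H" "t \<in> {a, v, b}" for h t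
    using that mult by blast
  have c1: "(h \<otimes> b) \<otimes> t \<in> ?S" if h: "h \<in> ?H" and t: "t \<in> {a, v, b}" for h t
  proof -
    have "(h \<otimes> b) \<otimes> b = h" "(h \<otimes> b) \<otimes> v = h \<otimes> (b \<otimes> v)" "(h \<otimes> b) \<otimes> a = (h \<otimes> a) \<otimes> b"
      using hc[OF h] assms ab by (simp_all add: m_assoc)
    then show ?thesis using t h mult[OF h, of a] by auto
  qed
  have c2: "(h \<otimes> (b \<otimes> v)) \<otimes> t \<in> ?S" if h: "h \<in> ?H" and t: "t \<in> {a, v, b}" for h t
  proof -
    have "(h \<otimes> (b \<otimes> v)) \<otimes> v = h \<otimes> b" "(h \<otimes> (b \<otimes> v)) \<otimes> a = h \<otimes> (b \<otimes> (v \<otimes> a))"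
      "(h \<otimes> (b \<otimes> v)) \<otimes> b = (h \<otimes> v) \<otimes> (b \<otimes> v)"
      using hc[OF h] assms vb by (simp_all add: m_assoc)
    then show ?thesis using t h mult[OF h, of v] by auto
  qed
  have c3: "(h \<otimes> (b \<otimes> (v \<otimes> a))) \<otimes> t \<in> ?S" if h: "h \<in> ?H" and t: "t \<in> {a, v, b}" for h t
  proof -
    have e1: "(h \<otimes> (b \<otimes> (v \<otimes> a))) \<otimes> a = h \<otimes> (b \<otimes> v)" using hc[OF h] assms by (simp add: m_assoc)
    have "(h \<otimes> (b \<otimes> (v \<otimes> a))) \<otimes> b = h \<otimes> ((b \<otimes> (v \<otimes> b)) \<otimes> a)"
      using hc[OF h] assms ab by (simp add: m_assoc)
    also have "\<dots> = (h \<otimes> v) \<otimes> (b \<otimes> (v \<otimes> a))"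
      unfolding vb[symmetric] using hc[OF h] assms by (simp add: m_assoc)
    finally have e2: "(h \<otimes> (b \<otimes> (v \<otimes> a))) \<otimes> b = (h \<otimes> v) \<otimes> (b \<otimes> (v \<otimes> a))" .
    have "(h \<otimes> (b \<otimes> (v \<otimes> a))) \<otimes> v = h \<otimes> (b \<otimes> (v \<otimes> (a \<otimes> v)))"
      using hc[OF h] assms by (simp add: m_assoc)
    also have "\<dots> = h \<otimes> ((b \<otimes> a) \<otimes> (v \<otimes> a))"
      unfolding av[symmetric] using assms by (simp add: m_assoc)
    also have "\<dots> = (h \<otimes> a) \<otimes> (b \<otimes> (v \<otimes> a))"
      unfolding ab[symmetric] using hc[OF h] assms by (simp add: m_assoc)
    finally have e3: "(h \<otimes> (b \<otimes> (v \<otimes> a))) \<otimes> v = (h \<otimes> a) \<otimes> (b \<otimes> (v \<otimes> a))" .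
    show ?thesis using t h mult[OF h, of v] mult[OF h, of a] e1 e2 e3 by auto
  qed
  show ?thesis
  proof (rule finite_generateI[where S = ?S])
    show "?S \<subseteq> carrier G" using hc assms by auto
    show "\<one> \<in> ?S" using generate.one by blast
    show "x \<otimes> t \<in> ?S" if "x \<in> ?S" "t \<in> {a, v, b}" for x t
      using that(1) c0[OF _ that(2)] c1[OF _ that(2)] c2[OF _ that(2)] c3[OF _ that(2)]
      by (elim UnE imageE) simp_all
  qed (use assms H in auto)
qed

section \<open>The canonical form and affine diagrams\<close>

abbreviation form :: "'a \<Rightarrow> 'a \<Rightarrow> real" where
  "form r s \<equiv> coxeter_form_entry G r s"

lemma form_sym: "r \<in> R \<Longrightarrow> s \<in> R \<Longrightarrow> form s r = form r s"
  by (simp add: coxeter_form_entry_def coxeter_m_sym)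

lemma form_self: "r \<in> R \<Longrightarrow> form r r = 1"
  using coxeter_m_eq_1_iff[of r r] by (simp add: coxeter_form_entry_def)

lemma form_eq_0: "coxeter_m G r s = 2 \<Longrightarrow> form r s = 0"
  by (simp add: coxeter_form_entry_def)

lemma coxeter_m_ge_3:
  assumes "r \<in> R" "s \<in> R" "r \<noteq> s" "coxeter_m G r s \<noteq> 2" "coxeter_m G r s \<noteq> 0"
  shows "3 \<le> coxeter_m G r s"
proof -
  have "coxeter_m G r s \<noteq> 1" using coxeter_m_eq_1_iff assms by simp
  then show ?thesis using assms by linarith
qed

text \<open>The value \<open>- cos (pi / m)\<close> decreases in \<open>m\<close> and equals
  \<open>- 1 / 2\<close> at \<open>m = 3\<close>; the entry \<open>-1\<close> of an infinite label
  lies below.\<close>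

lemma form_le:
  assumes "r \<in> R" "s \<in> R" "r \<noteq> s" "coxeter_m G r s \<noteq> 2"
  shows "form r s \<le> - 1 / 2"
proof (cases "coxeter_m G r s = 0")
  case False
  then have m: "3 \<le> coxeter_m G r s" using coxeter_m_ge_3 assms by blast
  then have "pi / real (coxeter_m G r s) \<le> pi / 3" by (intro divide_left_mono) auto
  moreover have "pi / 3 \<le> pi" by simp
  ultimately have "cos (pi / 3) \<le> cos (pi / real (coxeter_m G r s))"
    by (intro cos_monotone_0_pi_le) auto
  then show ?thesis using False by (simp add: coxeter_form_entry_def cos_60)
qed (simp add: coxeter_form_entry_def)

lemma form_eq_minus_half:
  assumes "r \<in> R" "s \<in> R" "r \<noteq> s" "form r s = - 1 / 2"
  shows "coxeter_m G r s = 3"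
proof (rule ccontr)
  assume ne: "coxeter_m G r s \<noteq> 3"
  have "coxeter_m G r s \<noteq> 2" "coxeter_m G r s \<noteq> 0"
    using assms(4) by (auto simp: coxeter_form_entry_def split: if_splits)
  then have m: "3 < coxeter_m G r s" using coxeter_m_ge_3[OF assms(1-3)] ne by linarith
  then have "pi / real (coxeter_m G r s) < pi / 3" by (intro divide_strict_left_mono) auto
  moreover have "pi / 3 \<le> pi" by simp
  ultimately have "cos (pi / 3) < cos (pi / real (coxeter_m G r s))"
    by (intro cos_monotone_0_pi) auto
  then show False using assms(4) m by (simp add: coxeter_form_entry_def cos_60)
qed

lemma form_gt_minus_one:
  assumes "r \<in> R" "s \<in> R" "coxeter_m G r s \<noteq> 0" "r \<noteq> s"
  shows "- 1 < form r s"
proof -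
  have "coxeter_m G r s \<noteq> 1" using coxeter_m_eq_1_iff assms by simp
  then have m: "1 < coxeter_m G r s" using assms by linarith
  then have "pi / real (coxeter_m G r s) < pi / 1" by (intro divide_strict_left_mono) auto
  then have "cos (pi / real (coxeter_m G r s)) < cos 0"
    using m by (intro cos_monotone_0_pi) auto
  then show ?thesis using assms by (simp add: coxeter_form_entry_def)
qed

lemma form_nonpos:
  assumes "r \<in> R" "s \<in> R" "r \<noteq> s"
  shows "form r s \<le> 0"
  using form_le[OF assms] form_eq_0[of r s] by fastforce

text \<open>Neighbours in the induced Coxeter diagram; infinite labels, encoded as 0, count as
  edges.\<close>

definition nbrs :: "'a set \<Rightarrow> 'a \<Rightarrow> 'a set" where
  "nbrs S r = {s \<in> S. s \<noteq> r \<and> coxeter_m G r s \<noteq> 2}"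

definition independent :: "'a set \<Rightarrow> bool" where
  "independent S \<longleftrightarrow> (\<forall>r\<in>S. \<forall>s\<in>S. r \<noteq> s \<longrightarrow> coxeter_m G r s = 2)"

lemma quadratic_form_restrict:
  assumes "finite R" "S \<subseteq> R" "\<And>r. r \<in> R - S \<Longrightarrow> v r = 0"
  shows "coxeter_quadratic_form G R v = (\<Sum>r\<in>S. \<Sum>s\<in>S. form r s * v r * v s)"
proof -
  have inner: "(\<Sum>s\<in>R. form r s * v r * v s) = (\<Sum>s\<in>S. form r s * v r * v s)" for r
    using assms by (intro sum.mono_neutral_right) auto
  show ?thesis
    unfolding coxeter_quadratic_form_def inner
    using assms by (intro sum.mono_neutral_right) (auto intro!: sum.neutral)
qed

text \<open>The right-hand side is the entry that would result if all edges had label 3.\<close>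

lemma form_le_indicator:
  assumes "r \<in> R" "s \<in> R"
  shows "form r s \<le> (if s = r then 1 else 0) - (if s \<noteq> r \<and> coxeter_m G r s \<noteq> 2 then 1 / 2 else 0)"
  using form_self[of r] form_eq_0[of r s] form_le[of r s] assms by auto

lemma sum_form_indicator:
  assumes "finite S" "r \<in> S"
  shows "(\<Sum>s\<in>S. (if s = r then 1 else 0) - (if s \<noteq> r \<and> coxeter_m G r s \<noteq> 2 then 1 / 2 else 0))
    = 1 - real (card (nbrs S r)) / 2"
proof -
  have "(\<Sum>s\<in>S. if s \<noteq> r \<and> coxeter_m G r s \<noteq> 2 then 1 / 2 else 0) = (\<Sum>s\<in>nbrs S r. 1 / 2 :: real)"
    unfolding nbrs_def by (rule sum.inter_filter[OF assms(1), symmetric])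
  then show ?thesis using assms by (simp add: sum_subtractf sum.delta)
qed

text \<open>Summed over all \<open>r\<close> in \<open>S\<close>, the bound is the number of
  vertices minus the number of edges of the subdiagram, so positivity of the form limits the
  edges.\<close>

lemma sum_form_row_le:
  assumes "finite S" "S \<subseteq> R" "r \<in> S"
  shows "(\<Sum>s\<in>S. form r s) \<le> 1 - real (card (nbrs S r)) / 2"
  unfolding sum_form_indicator[OF assms(1,3), symmetric]
  using assms form_le_indicator by (intro sum_mono) blast

end

section \<open>Affine diagrams: forests, leaves and cycles\<close>

locale affine_system = coxeter_system +
  assumes affine: "affine_coxeter G R"
begin

lemma finite_R: "finite R"
  using affine by (simp add: affine_coxeter_def)

lemma irreducible: "coxeter_irreducible G R"
  using affine by (simp add: affine_coxeter_def)

lemma form_sum_nonneg: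
  assumes "S \<subseteq> R"
  shows "0 \<le> (\<Sum>r\<in>S. \<Sum>s\<in>S. form r s)"
proof -
  let ?v = "\<lambda>r. if r \<in> S then 1 else 0"
  have "0 \<le> coxeter_quadratic_form G R ?v" using affine by (simp add: affine_coxeter_def)
  also have "\<dots> = (\<Sum>r\<in>S. \<Sum>s\<in>S. form r s * ?v r * ?v s)"
    by (rule quadratic_form_restrict[OF finite_R assms]) simp
  also have "\<dots> = (\<Sum>r\<in>S. \<Sum>s\<in>S. form r s)" by (intro sum.cong refl) simp
  finally show ?thesis .
qed

text \<open>If the form vanished on the indicator vector of a proper subset \<open>S\<close>, adding half a simple root
  outside \<open>S\<close> but joined to \<open>S\<close> would make it negative.\<close>

lemma form_sum_pos:
  assumes "S \<subset> R" "S \<noteq> {}"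
  shows "0 < (\<Sum>r\<in>S. \<Sum>s\<in>S. form r s)"
proof -
  obtain r t where rt: "r \<in> S" "t \<in> R - S" "coxeter_m G r t \<noteq> 2"
    using irreducible assms unfolding coxeter_irreducible_def by blast
  have finS: "finite S" using assms finite_R by (auto intro: finite_subset)
  have SR: "S \<subseteq> R" using assms by blast
  let ?v = "\<lambda>x. if x \<in> S then 1 else if x = t then 1 / 2 else (0::real)"
  let ?Q = "\<Sum>x\<in>S. \<Sum>y\<in>S. form x y"
  have tS: "t \<notin> S" using rt by blast
  have "0 \<le> coxeter_quadratic_form G R ?v" using affine by (simp add: affine_coxeter_def)
  also have "\<dots> = (\<Sum>x\<in>insert t S. \<Sum>y\<in>insert t S. form x y * ?v x * ?v y)"
    by (rule quadratic_form_restrict[OF finite_R]) (use SR rt in auto)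
  also have "\<dots> = (\<Sum>y\<in>insert t S. form t y * ?v t * ?v y)
      + (\<Sum>x\<in>S. \<Sum>y\<in>insert t S. form x y * ?v x * ?v y)"
    by (rule sum.insert[OF finS tS])
  also have "(\<Sum>y\<in>insert t S. form t y * ?v t * ?v y) = 1 / 4 + (\<Sum>y\<in>S. form t y / 2)"
    using finS tS rt form_self[of t] by (simp add: sum.insert)
  also have "(\<Sum>x\<in>S. \<Sum>y\<in>insert t S. form x y * ?v x * ?v y) = (\<Sum>x\<in>S. form x t / 2 + (\<Sum>y\<in>S. form x y))"
    using finS tS by (intro sum.cong refl) (simp add: sum.insert)
  also have "\<dots> = (\<Sum>x\<in>S. form x t / 2) + ?Q" by (rule sum.distrib)
  also have "(\<Sum>x\<in>S. form x t / 2) = (\<Sum>x\<in>S. form t x / 2)"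
    using SR rt form_sym by (intro sum.cong refl) auto
  finally have ge: "0 \<le> 1 / 4 + (\<Sum>x\<in>S. form t x / 2) + ((\<Sum>x\<in>S. form t x / 2) + ?Q)" .
  have "(\<Sum>x\<in>S. form t x / 2) = form t r / 2 + (\<Sum>x\<in>S - {r}. form t x / 2)"
    using finS rt by (simp add: sum.remove)
  moreover have "(\<Sum>x\<in>S - {r}. form t x / 2) \<le> 0"
    using form_nonpos[of t] SR rt by (intro sum_nonpos) auto
  moreover have "form t r \<le> - 1 / 2"
    using form_le[of t r] rt SR coxeter_m_sym[of r t] by auto
  ultimately have "(\<Sum>x\<in>S. form t x / 2) \<le> - 1 / 4" by linarith
  then show ?thesis using ge by linarith
qed

text \<open>If all degrees were at least 2, every row sum would be at most 0, against positivity on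
  the indicator vector of \<open>S\<close>. Applied to all subsets, this says that proper
  subdiagrams are forests.\<close>

lemma ex_degree_le_1:
  assumes "S \<subset> R" "S \<noteq> {}"
  shows "\<exists>r\<in>S. card (nbrs S r) \<le> 1"
proof (rule ccontr)
  assume "\<not> ?thesis"
  then have deg: "2 \<le> card (nbrs S r)" if "r \<in> S" for r using that by force
  have finS: "finite S" using assms finite_R by (auto intro: finite_subset)
  have "(\<Sum>r\<in>S. \<Sum>s\<in>S. form r s) \<le> 0"
  proof (rule sum_nonpos)
    fix r assume r: "r \<in> S"
    have "(\<Sum>s\<in>S. form r s) \<le> 1 - real (card (nbrs S r)) / 2"
      using sum_form_row_le finS assms r by blast
    then show "(\<Sum>s\<in>S. form r s) \<le> 0" using deg[OF r] by linarith
  qed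
  then show False using form_sum_pos[OF assms] by linarith
qed

text \<open>A vertex with at most one neighbour is removed, the rest is coloured by induction, and
  the vertex joins a class that does not contain its neighbour.\<close>

lemma two_colouring:
  "S \<subset> R \<Longrightarrow> \<exists>J K. J \<union> K = S \<and> J \<inter> K = {} \<and> independent J \<and> independent K"
proof (induction "card S" arbitrary: S rule: less_induct)
  case less
  show ?case
  proof (cases "S = {}")
    case True
    then show ?thesis by (auto simp: independent_def)
  next
    case False
    have finS: "finite S" using less.prems finite_R by (auto intro: finite_subset)
    obtain r where r: "r \<in> S" "card (nbrs S r) \<le> 1" using ex_degree_le_1[OF less.prems False] by blast
    have "card (S - {r}) < card S" using r finS by (meson card_Diff1_less)
    then obtain J K where JK: "J \<union> K = S - {r}" "J \<inter> K = {}" "independent J" "independent K"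
      using less.hyps[of "S - {r}"] less.prems by blast
    have insert_indep: "independent (insert r L)" if "independent L" "L \<subseteq> S" "nbrs S r \<inter> L = {}" for L
    proof -
      have "coxeter_m G r s = 2" "coxeter_m G s r = 2" if "s \<in> L" "s \<noteq> r" for s
      proof -
        show m: "coxeter_m G r s = 2"
          using that \<open>L \<subseteq> S\<close> \<open>nbrs S r \<inter> L = {}\<close> by (auto simp: nbrs_def)
        have "r \<in> R" "s \<in> R" using that(1) \<open>L \<subseteq> S\<close> r(1) less.prems by auto
        then show "coxeter_m G s r = 2" using coxeter_m_sym m by simp
      qed
      then show ?thesis using \<open>independent L\<close> by (auto simp: independent_def)
    qed
    have "finite (nbrs S r)" using finS by (simp add: nbrs_def)
    then have single: "a = b" if "a \<in> nbrs S r" "b \<in> nbrs S r" for a b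
      using that r(2) card_le_Suc0_iff_eq[of "nbrs S r"] by simp
    have "nbrs S r \<inter> J = {} \<or> nbrs S r \<inter> K = {}"
    proof (rule ccontr)
      assume "\<not> ?thesis"
      then obtain a b where "a \<in> nbrs S r" "a \<in> J" "b \<in> nbrs S r" "b \<in> K" by auto
      then show False using single[of a b] JK(2) by auto
    qed
    then show ?thesis
    proof
      assume "nbrs S r \<inter> J = {}"
      then have "independent (insert r J)" using insert_indep[of J] JK by blast
      then show ?thesis using JK r(1) by (intro exI[of _ "insert r J"] exI[of _ K]) auto
    next
      assume "nbrs S r \<inter> K = {}"
      then have "independent (insert r K)" using insert_indep[of K] JK by blast
      then show ?thesis using JK r(1) by (intro exI[of _ J] exI[of _ "insert r K"]) auto
    qed
  qed
qed

text \<open>In rank at least 3 the pair \<open>{r, s}\<close> is proper, but with an infinite label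
  the form on its indicator vector would be \<open>2 - 2 = 0\<close>.\<close>

lemma coxeter_m_nonzero:
  assumes "3 \<le> card R" "r \<in> R" "s \<in> R"
  shows "coxeter_m G r s \<noteq> 0"
proof
  assume m: "coxeter_m G r s = 0"
  then have ne: "r \<noteq> s" using coxeter_m_eq_1_iff[of r s] assms by auto
  have "{r, s} \<noteq> R" using assms(1) ne by auto
  then have "0 < (\<Sum>x\<in>{r, s}. \<Sum>y\<in>{r, s}. form x y)"
    using assms by (intro form_sum_pos) auto
  then have "0 < 2 + 2 * form r s" using ne form_self form_sym assms by simp
  then show False using m by (simp add: coxeter_form_entry_def)
qed

text \<open>Without leaves the inequality \<open>B(v, v) \<ge> 0\<close> at \<open>v = \<Sum>\<^sub>r \<alpha>\<^sub>r\<close> is an equality in every term: the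
  diagram is a cycle all of whose edges have label \<open>3\<close>.\<close>

lemma no_leaf:
  assumes "\<And>r. r \<in> R \<Longrightarrow> 2 \<le> card (nbrs R r)" "r \<in> R"
  shows "card (nbrs R r) = 2" "s \<in> nbrs R r \<Longrightarrow> coxeter_m G r s = 3"
proof -
  let ?row = "\<lambda>r. \<Sum>s\<in>R. form r s"
  let ?b = "\<lambda>s. (if s = r then 1 else 0) - (if s \<noteq> r \<and> coxeter_m G r s \<noteq> 2 then 1 / 2 else (0::real))"
  have row: "?row x \<le> 1 - real (card (nbrs R x)) / 2" if "x \<in> R" for x
    using sum_form_row_le[OF finite_R subset_refl that] .
  have nonpos: "?row x \<le> 0" if "x \<in> R" for x
    using row[OF that] assms(1)[OF that] by linarith
  have "(\<Sum>x\<in>R. ?row x) = ?row r + (\<Sum>x\<in>R - {r}. ?row x)"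
    by (rule sum.remove[OF finite_R assms(2)])
  moreover have "(\<Sum>x\<in>R - {r}. ?row x) \<le> 0" by (rule sum_nonpos) (use nonpos in blast)
  ultimately have row0: "0 \<le> ?row r" using form_sum_nonneg[of R] by simp
  then show c2: "card (nbrs R r) = 2" using row[OF assms(2)] assms(1)[OF assms(2)] by linarith
  assume s: "s \<in> nbrs R r"
  then have sR: "s \<in> R" "s \<noteq> r" "coxeter_m G r s \<noteq> 2" by (auto simp: nbrs_def)
  have "(\<Sum>x\<in>R. ?b x - form r x) = 1 - real (card (nbrs R r)) / 2 - ?row r"
    unfolding sum_subtractf[of ?b] sum_form_indicator[OF finite_R assms(2)] ..
  also have "\<dots> \<le> 0" using row0 c2 by simp
  finally have le: "(\<Sum>x\<in>R. ?b x - form r x) \<le> 0" .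
  have "?b s - form r s \<le> (\<Sum>x\<in>R. ?b x - form r x)"
  proof (rule member_le_sum[OF sR(1) _ finite_R])
    fix x assume "x \<in> R - {s}"
    then show "0 \<le> ?b x - form r x" using form_le_indicator[OF assms(2), of x] by simp
  qed
  then have "- 1 / 2 \<le> form r s" using le sR by simp
  then have "form r s = - 1 / 2" using form_le[OF assms(2) sR(1)] sR by simp
  then show "coxeter_m G r s = 3" using form_eq_minus_half assms(2) sR by blast
qed

text \<open>With at most one neighbour in \<open>M\<close> the subgroup lies in a dihedral one. Two
  neighbours occur only when both edges have label 3; as they commute, the type is then
  \<open>A3\<close> with \<open>v\<close> in the middle.\<close>

lemma finite_star:
  assumes "3 \<le> card R" "v \<in> R" "M \<subseteq> nbrs R v" "independent M"
    and "card (nbrs R v) \<le> 1 \<or> (card (nbrs R v) = 2 \<and> (\<forall>s\<in>nbrs R v. coxeter_m G v s = 3))"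
  shows "finite (generate G (insert v M))"
proof -
  have finN: "finite (nbrs R v)" using finite_R by (simp add: nbrs_def)
  have MR: "M \<subseteq> R" using assms(3) by (auto simp: nbrs_def)
  have finM: "finite M" using finN assms(3) by (rule rev_finite_subset)
  have le: "card M \<le> card (nbrs R v)" by (rule card_mono[OF finN assms(3)])
  have single: ?thesis if "M \<subseteq> {u}" "u \<in> R" for u
  proof -
    have "finite (generate G {v, u})"
      using finite_generate_dihedral[of v u] coxeter_m_nonzero assms(1,2) that by simp
    moreover have "insert v M \<subseteq> {v, u}" using that by blast
    then have "generate G (insert v M) \<subseteq> generate G {v, u}" by (rule mono_generate)
    ultimately show ?thesis by (rule rev_finite_subset)
  qed
  consider "card M = 0" | "card M = 1" | "card M = 2" "\<forall>s\<in>nbrs R v. coxeter_m G v s = 3"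
    using le assms(5) by linarith
  then show ?thesis
  proof cases
    case 1
    \<comment> \<open>For empty \<open>M\<close> the choice \<open>u = v\<close> is a dummy, with
      label 1.\<close>
    then show ?thesis using single[of v] finM assms(2) by simp
  next
    case 2
    then obtain u where "M = {u}" by (auto simp: card_1_singleton_iff)
    then show ?thesis using single[of u] MR by simp
  next
    case 3
    then obtain a b where ab: "M = {a, b}" "a \<noteq> b" by (auto simp: card_2_iff)
    then have abR: "a \<in> R" "b \<in> R" "coxeter_m G v a = 3" "coxeter_m G v b = 3" "coxeter_m G a b = 2"
      using MR 3(2) assms(3,4) by (auto simp: independent_def)
    then have "finite (generate G {a, v, b})"
      using finite_generate_A3[of a v b] coxeter_m_sym[of v a] assms(2) by simp
    moreover have "insert v M = {a, v, b}" using ab by auto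
    ultimately show ?thesis by simp
  qed
qed

lemma graph_diam_affine_infinite:
  assumes "3 \<le> card R" "infinite (carrier G)"
  shows "graph_diam (reduced_excess_zero_graph G R) = 3"
proof -
  have "R \<noteq> {}" using assms(1) by auto
  \<comment> \<open>Either \<open>v\<close> is a vertex of degree at most 1, or all degrees are at
    least 2 and \<open>no_leaf\<close> applies to any generator.\<close>
  obtain v where v: "v \<in> R"
    "card (nbrs R v) \<le> 1 \<or> (card (nbrs R v) = 2 \<and> (\<forall>s\<in>nbrs R v. coxeter_m G v s = 3))"
  proof (cases "\<exists>v\<in>R. card (nbrs R v) \<le> 1")
    case False
    then have "2 \<le> card (nbrs R r)" if "r \<in> R" for r using that by force
    then show thesis using no_leaf that \<open>R \<noteq> {}\<close> by blast
  qed (use that in blast)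
  obtain J K where JK: "J \<union> K = R - {v}" "J \<inter> K = {}" "independent J" "independent K"
    using two_colouring[of "R - {v}"] v(1) by blast
  \<comment> \<open>All edges inside \<open>insert v L\<close> meet \<open>v\<close>: the star of
    \<open>v\<close> generates a finite subgroup, and the remaining generators commute with it and
    with each other.\<close>
  have fin: "finite (generate G (insert v L))" if L: "L \<subseteq> R - {v}" "independent L" for L
  proof -
    let ?M = "nbrs L v"
    have M: "?M \<subseteq> L" "?M \<subseteq> nbrs R v" using L by (auto simp: nbrs_def)
    have "independent ?M" using L(2) M(1) unfolding independent_def by blast
    then have star: "finite (generate G (insert v ?M))"
      using finite_star[OF assms(1) v(1) M(2) _ v(2)] by blast
    have "finite (generate G ((L - ?M) \<union> insert v ?M))"
    proof (rule finite_generate_union[OF _ _ star])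
      show "finite (L - ?M)" using L finite_R by (auto intro: finite_subset)
      show "L - ?M \<union> insert v ?M \<subseteq> R" using L v(1) M by blast
      show "(L - ?M) \<inter> insert v ?M = {}" using L by blast
      fix a b assume a: "a \<in> L - ?M" and b: "b \<in> L - ?M \<union> insert v ?M" and "a \<noteq> b"
      show "coxeter_m G a b = 2"
      proof (cases "b = v")
        case True
        have "coxeter_m G v a = 2" using a L by (auto simp: nbrs_def)
        then show ?thesis using True coxeter_m_sym[of v a] a L v(1) by auto
      next
        case False
        then have "b \<in> L" using b M by blast
        then show ?thesis using a L(2) \<open>a \<noteq> b\<close> by (auto simp: independent_def)
      qed
    qed
    moreover have "(L - ?M) \<union> insert v ?M = insert v L" using M by blast
    ultimately show ?thesis by simp
  qed
  have fJ: "finite (generate G (insert v J))" and fK: "finite (generate G (insert v K))"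
    using fin JK by blast+
  \<comment> \<open>Properness comes from cardinality: these subgroups are finite, the whole group
    is not.\<close>
  have "insert v J \<noteq> R" "insert v K \<noteq> R"
    using fJ fK assms(2) gens_generate by auto
  then show ?thesis
    using JK v(1) fJ fK finite_R
    by (intro graph_diam_3_parabolic[of "insert v J" "insert v K"]) auto
qed

text \<open>For a finite label the off-diagonal entry \<open>B\<close> satisfies
  \<open>-1 < B \<le> 0\<close>, and completing the square shows that the form is positive
  definite.\<close>

lemma affine_rank_2:
  assumes "R = {r, s}" "r \<noteq> s"
  shows "coxeter_m G r s = 0"
proof (rule ccontr)
  assume m: "coxeter_m G r s \<noteq> 0"
  have rs: "r \<in> R" "s \<in> R" using assms by auto
  define B where "B = form r s"
  have B: "- 1 < B" "B \<le> 0"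
    using form_gt_minus_one[OF rs m assms(2)] form_nonpos[OF rs assms(2)] by (auto simp: B_def)
  have pos: "0 < coxeter_quadratic_form G R v" if "\<exists>r\<in>R. v r \<noteq> 0" for v
  proof -
    have "coxeter_quadratic_form G R v = v r * v r + B * v r * v s + (B * v s * v r + v s * v s)"
      using assms form_self[OF rs(1)] form_self[OF rs(2)] form_sym[OF rs]
      by (simp add: coxeter_quadratic_form_def B_def)
    also have "\<dots> = (v r + B * v s)\<^sup>2 + (1 - B\<^sup>2) * (v s)\<^sup>2"
      by (simp add: power2_eq_square algebra_simps)
    finally have eq: "coxeter_quadratic_form G R v = (v r + B * v s)\<^sup>2 + (1 - B\<^sup>2) * (v s)\<^sup>2" .
    have "B\<^sup>2 < 1" using B abs_square_less_1[of B] by simp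
    then show ?thesis
    proof (cases "v s = 0")
      case True
      then show ?thesis using eq that assms by simp
    next
      case False
      then have "0 < (1 - B\<^sup>2) * (v s)\<^sup>2" using \<open>B\<^sup>2 < 1\<close> by simp
      then show ?thesis using eq by (simp add: add_nonneg_pos)
    qed
  qed
  then show False using affine by (simp add: affine_coxeter_def)
qed

end

section \<open>Diameters for finite, affine and compact hyperbolic systems\<close>

context coxeter_system
begin

text \<open>The form becomes the square of \<open>v r - v s\<close>, which vanishes at the constant
  vector 1. This excludes infinite labels in rank two from the compact hyperbolic case.\<close>

lemma rank_2_affine:
  assumes "R = {r, s}" "r \<noteq> s" "coxeter_m G r s = 0" "coxeter_irreducible G R"
  shows "affine_coxeter G R"
proof -
  have rs: "r \<in> R" "s \<in> R" using assms by auto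
  have B: "form r s = - 1" using assms(3) by (simp add: coxeter_form_entry_def)
  have eq: "coxeter_quadratic_form G R v = (v r - v s)\<^sup>2" for v
    using assms(1,2) form_self[OF rs(1)] form_self[OF rs(2)] form_sym[OF rs] B
    by (simp add: coxeter_quadratic_form_def power2_eq_square algebra_simps)
  have "\<exists>v. (\<exists>r\<in>R. v r \<noteq> 0) \<and> \<not> 0 < coxeter_quadratic_form G R v"
    unfolding eq using rs by (intro exI[of _ "\<lambda>_. 1"]) auto
  then show ?thesis using assms unfolding affine_coxeter_def eq by auto
qed

lemma graph_diam_finite:
  assumes "finite (carrier G)" "2 \<le> card R"
  shows "graph_diam (reduced_excess_zero_graph G R) = (if type_A2 G R \<or> type_A1_A1 G R then 1 else 3)"
proof -
  have finR: "finite R" using gens_subset assms(1) by (rule finite_subset)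
  consider "card R = 2" | "3 \<le> card R" using assms(2) by linarith
  then show ?thesis
  proof cases
    case 1
    then obtain r s where R: "R = {r, s}" "r \<noteq> s" by (auto simp: card_2_iff)
    then have rs: "r \<in> R" "s \<in> R" by auto
    have m: "coxeter_m G r s \<noteq> 0" "coxeter_m G r s \<noteq> 1"
      using graph_diam_infinite_dihedral(1)[OF R] assms(1) coxeter_m_eq_1_iff[OF rs] R(2) by auto
    have types: "type_A2 G R \<longleftrightarrow> coxeter_m G r s = 3" "type_A1_A1 G R \<longleftrightarrow> coxeter_m G r s = 2"
      using R coxeter_m_sym[OF rs] by (auto simp: type_A2_def type_A1_A1_def doubleton_eq_iff)
    show ?thesis
    proof (cases "coxeter_m G r s = 2 \<or> coxeter_m G r s = 3")
      case True
      then show ?thesis using graph_diam_small_dihedral[OF R] types by auto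
    next
      case False
      then have "4 \<le> coxeter_m G r s" using m by linarith
      then show ?thesis using graph_diam_dihedral[OF R] types False by auto
    qed
  next
    case 2
    have "finite (generate G J)" if "J \<subset> R" for J
      using generate_closed[of J] that assms(1) by (blast intro: finite_subset)
    then have "graph_diam (reduced_excess_zero_graph G R) = 3"
      using graph_diam_finite_maximal_parabolics finR 2 by blast
    moreover have "\<not> type_A2 G R" "\<not> type_A1_A1 G R"
      using 2 by (auto simp: type_A2_def type_A1_A1_def card_insert_if split: if_splits)
    ultimately show ?thesis by simp
  qed
qed

lemma graph_diam_affine:
  assumes "affine_coxeter G R" "2 \<le> card R"
  shows "graph_diam (reduced_excess_zero_graph G R) = (if type_affine_A1 G R then 2 else 3)"
proof -
  interpret affine_system G R by unfold_locales (rule assms(1))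
  consider "card R = 2" | "3 \<le> card R" using assms(2) by linarith
  then show ?thesis
  proof cases
    case 1
    then obtain r s where R: "R = {r, s}" "r \<noteq> s" by (auto simp: card_2_iff)
    then have m: "coxeter_m G r s = 0" by (rule affine_rank_2)
    then have "type_affine_A1 G R" using R by (auto simp: type_affine_A1_def)
    then show ?thesis using graph_diam_infinite_dihedral(2)[OF R m] by simp
  next
    case 2
    then have "\<not> type_A2 G R" "\<not> type_A1_A1 G R" "\<not> type_affine_A1 G R"
      by (auto simp: type_A2_def type_A1_A1_def type_affine_A1_def card_insert_if split: if_splits)
    \<comment> \<open>In rank at least 3 the value is 3 in either case: a finite group falls under
      the finite classification, an infinite one has the two finite parabolic subgroups.\<close>
    then show ?thesis
      using graph_diam_finite graph_diam_affine_infinite[OF 2] assms(2)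
      by (cases "finite (carrier G)") auto
  qed
qed

text \<open>All generators but one lie in a proper parabolic subgroup, which is finite.\<close>

lemma compact_hyperbolic_finite_gens:
  assumes "compact_hyperbolic G R"
  shows "finite R"
proof -
  obtain r where r: "r \<in> R"
    using assms by (auto simp: compact_hyperbolic_def coxeter_irreducible_def)
  then have "finite (generate G (R - {r}))" using assms by (auto simp: compact_hyperbolic_def)
  moreover have "R - {r} \<subseteq> generate G (R - {r})" by (auto intro: generate.incl)
  ultimately show ?thesis by (metis finite_Diff_insert finite.emptyI Diff_empty finite_subset)
qed

text \<open>Rank two is impossible: a finite label makes the group finite, an infinite one makes it
  affine. In higher rank all proper parabolic subgroups are finite by definition.\<close>

lemma graph_diam_compact_hyperbolic:
  assumes "compact_hyperbolic G R" "2 \<le> card R"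
  shows "graph_diam (reduced_excess_zero_graph G R) = 3"
proof -
  note hyp = assms(1)[unfolded compact_hyperbolic_def]
  have "card R \<noteq> 2"
  proof
    assume "card R = 2"
    then obtain r s where R: "R = {r, s}" "r \<noteq> s" by (auto simp: card_2_iff)
    then have "coxeter_m G r s \<noteq> 0" using rank_2_affine hyp by blast
    then have "finite (generate G R)" using finite_generate_dihedral[of r s] R by simp
    then show False using hyp gens_generate by simp
  qed
  then show ?thesis
    using assms(2) compact_hyperbolic_finite_gens[OF assms(1)] hyp
    by (intro graph_diam_finite_maximal_parabolics) auto
qed

end

theorem theorem3p4:
  fixes G :: "('a, 'b) monoid_scheme" and R :: "'a set"
  assumes "coxeter_system G R"
    and "2 \<le> coxeter_rank R"
  shows "(finite (carrier G) \<longrightarrow>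
            graph_diam (reduced_excess_zero_graph G R) =
              (if type_A2 G R \<or> type_A1_A1 G R then 1 else 3)) \<and>
         (affine_coxeter G R \<longrightarrow>
            graph_diam (reduced_excess_zero_graph G R) =
              (if type_affine_A1 G R then 2 else 3)) \<and>
         (compact_hyperbolic G R \<longrightarrow>
            graph_diam (reduced_excess_zero_graph G R) = 3)"
proof -
  interpret coxeter_system G R by (rule assms(1))
  have card: "2 \<le> card R" if "finite R"
    using assms(2) that by (simp add: coxeter_rank_def numeral_eq_enat)
  have "finite R" if "finite (carrier G)" using gens_subset that by (rule finite_subset)
  moreover have "finite R" if "affine_coxeter G R" using that by (simp add: affine_coxeter_def)
  ultimately show ?thesis
    using card graph_diam_finite graph_diam_affine graph_diam_compact_hyperbolic
      compact_hyperbolic_finite_gens by blast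
qed

end
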